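(* Let $0\leq\alpha\leq\rho$, $\rho>0$, $0<\gamma<\sigma\leq 1$, $\delta\in\{-1,1\}$, $p>1$ and $\frac1p+\frac1q=1$. Suppose there exists $n_0\in\mathbf N$ such that $\nu_n\geq\nu_{n+1}$ for all $n\in\{n_0,n_0+1,\dots\}$, and $U(\infty)=V(\infty)=\infty$. Then the constant factor $k(\sigma)$ is the best possible in each of the following inequalities, which are valid for all functions $f\ge 0$ on $\mathbf R_+$ and all sequences $a=\{a_n\}_{n=1}^\infty$, $a_n\ge0$, with $0<\|f\|_{p,\Phi_\delta}<\infty$ and $0<\|a\|_{q,\widetilde\Psi}<\infty$: $$\sum_{n=1}^{\infty}\int_0^\infty H_\delta(x,n)\,a_nf(x)\,dx<k(\sigma)\|f\|_{p,\Phi_\delta}\|a\|_{q,\widetilde\Psi},$$ $$\left\{\sum_{n=1}^\infty\frac{\nu_n}{\widetilde V_n^{1-p\sigma}}\left[\int_0^\infty H_\delta(x,n)f(x)\,dx\right]^p\right\}^{\frac1p}<k(\sigma)\|f\|_{p,\Phi_\delta},$$ $$\left\{\int_0^\infty\frac{\mu(x)}{U^{1-q\delta\sigma}(x)}\left[\sum_{n=1}^\infty H_\delta(x,n)a_n\right]^q dx\right\}^{\frac1q}<k(\sigma)\|a\|_{q,\widetilde\Psi}.$$ That is, in none of these inequalities can $k(\sigma)$ be replaced by a smaller constant so that the inequality remains valid for all such $f$ and $a$.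
   Context: $\mathbf{N}=\{1,2,\dots\}$, $\mathbf{R}_+=(0,\infty)$. $\nu_n>0$ ($n\in\mathbf N$) are given reals, $V_n:=\sum_{j=1}^n\nu_j$, $\widetilde\nu_n\in[0,\frac{\nu_n}{2}]$, $\widetilde V_n:=V_n-\widetilde\nu_n$. $\mu$ is a positive continuous function on $\mathbf R_+$ with $U(x):=\int_0^x\mu(t)\,dt<\infty$ for $x\in[0,\infty)$, and $U(\infty):=\int_0^\infty\mu(t)\,dt$. $\nu(t):=\nu_n$ for $t\in(n-\frac12,n+\frac12]$, $V(y):=\int_{1/2}^y\nu(t)\,dt$ for $y\ge\frac12$, and $V(\infty):=\lim_{y\to\infty}V(y)=\sum_{n=1}^\infty\nu_n$. Powers such as $U^{s}(x)$ mean $(U(x))^{s}$. Functions are assumed measurable. $\operatorname{csch}(u):=\frac{2}{e^u-e^{-u}}$ for $u>0$. The kernel is $$H_\delta(x,n):=\frac{\operatorname{csch}\big(\rho(U^\delta(x)\widetilde V_n)^\gamma\big)}{e^{\alpha(U^\delta(x)\widetilde V_n)^\gamma}}.$$ $\Phi_\delta(x):=\frac{U^{p(1-\delta\sigma)-1}(x)}{\mu^{p-1}(x)}$, $\widetilde\Psi(n):=\frac{\widetilde V_n^{q(1-\sigma)-1}}{\nu_n^{q-1}}$, $\|f\|_{p,\Phi_\delta}:=\left(\int_0^\infty\Phi_\delta(x)f^p(x)\,dx\right)^{1/p}$, $\|a\|_{q,\widetilde\Psi}:=\left(\sum_{n=1}^\infty\widetilde\Psi(n)a_n^q\right)^{1/q}$.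 $$k(\sigma):=\int_0^\infty\frac{\operatorname{csch}(\rho t^\gamma)}{e^{\alpha t^\gamma}}t^{\sigma-1}dt=\frac{2\Gamma(\frac\sigma\gamma)}{\gamma(2\rho)^{\sigma/\gamma}}\zeta\Big(\frac\sigma\gamma,\frac{\alpha+\rho}{2\rho}\Big),$$ where $\zeta(s,a):=\sum_{k=0}^\infty\frac1{(k+a)^s}$ ($s>1$, $0<a\le1$) is the Hurwitz zeta function and $\Gamma$ is the Gamma function. *)

theory Defs
  imports "HOL-Analysis.Analysis"
begin

text \<open>
  Sequences indexed by the positive integers are functions on \<^typ>\<open>nat\<close> whose value at \<open>0\<close>
  is never used; series over them are written \<open>\<Sum>n. g (Suc n)\<close>.  Integrals and series of
  nonnegative terms that may diverge are taken in \<^typ>\<open>ennreal\<close>, so that a strict inequality with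
  finite right-hand side includes convergence of the left-hand side.
\<close>

text \<open>Real powers of extended nonnegative reals, meant for exponents \<open>s > 0\<close>.\<close>

definition epowr :: "ennreal \<Rightarrow> real \<Rightarrow> ennreal" (infixr "epowr" 80) where
  "x epowr s = (if x = \<infinity> then \<infinity> else ennreal (enn2real x powr s))"

definition csch :: "real \<Rightarrow> real" where
  "csch u = 2 / (exp u - exp (- u))"

definition partial_sum :: "(nat \<Rightarrow> real) \<Rightarrow> nat \<Rightarrow> real" where
  "partial_sum \<nu> n = (\<Sum>j = 1..n. \<nu> j)"

text \<open>In \<open>Vt \<nu> \<nu>t\<close>, the argument \<open>\<nu>t\<close> is the perturbation \<open>\<nu>\<close>-tilde, and the value is \<open>V\<close>-tilde.\<close>

definition Vt :: "(nat \<Rightarrow> real) \<Rightarrow> (nat \<Rightarrow> real) \<Rightarrow> nat \<Rightarrow> real" where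
  "Vt \<nu> \<nu>t n = partial_sum \<nu> n - \<nu>t n"

definition V_inf :: "(nat \<Rightarrow> real) \<Rightarrow> ennreal" where
  "V_inf \<nu> = (\<Sum>n. ennreal (\<nu> (Suc n)))"

definition U :: "(real \<Rightarrow> real) \<Rightarrow> real \<Rightarrow> real" where
  "U \<mu> x = (LINT t:{0<..<x}|lebesgue. \<mu> t)"

definition U_inf :: "(real \<Rightarrow> real) \<Rightarrow> ennreal" where
  "U_inf \<mu> = (\<integral>\<^sup>+t\<in>{0<..}. ennreal (\<mu> t) \<partial>lebesgue)"

definition H :: "real \<Rightarrow> real \<Rightarrow> real \<Rightarrow> real \<Rightarrow> (real \<Rightarrow> real) \<Rightarrow> (nat \<Rightarrow> real) \<Rightarrow> (nat \<Rightarrow> real)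
    \<Rightarrow> real \<Rightarrow> nat \<Rightarrow> real" where
  "H \<alpha> \<rho> \<gamma> \<delta> \<mu> \<nu> \<nu>t x n =
     csch (\<rho> * (U \<mu> x powr \<delta> * Vt \<nu> \<nu>t n) powr \<gamma>) /
     exp (\<alpha> * (U \<mu> x powr \<delta> * Vt \<nu> \<nu>t n) powr \<gamma>)"

definition k_const :: "real \<Rightarrow> real \<Rightarrow> real \<Rightarrow> real \<Rightarrow> real" where
  "k_const \<alpha> \<rho> \<gamma> \<sigma> =
     (LINT t:{0<..}|lebesgue. csch (\<rho> * t powr \<gamma>) / exp (\<alpha> * t powr \<gamma>) * t powr (\<sigma> - 1))"

definition \<Phi> :: "real \<Rightarrow> real \<Rightarrow> real \<Rightarrow> (real \<Rightarrow> real) \<Rightarrow> real \<Rightarrow> real" where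
  "\<Phi> p \<delta> \<sigma> \<mu> x = U \<mu> x powr (p * (1 - \<delta> * \<sigma>) - 1) / \<mu> x powr (p - 1)"

definition \<Psi>t :: "real \<Rightarrow> real \<Rightarrow> (nat \<Rightarrow> real) \<Rightarrow> (nat \<Rightarrow> real) \<Rightarrow> nat \<Rightarrow> real" where
  "\<Psi>t q \<sigma> \<nu> \<nu>t n = Vt \<nu> \<nu>t n powr (q * (1 - \<sigma>) - 1) / \<nu> n powr (q - 1)"

definition fun_norm :: "real \<Rightarrow> (real \<Rightarrow> real) \<Rightarrow> (real \<Rightarrow> real) \<Rightarrow> ennreal" where
  "fun_norm p w f = (\<integral>\<^sup>+x\<in>{0<..}. ennreal (w x * f x powr p) \<partial>lebesgue) epowr (1 / p)"

definition seq_norm :: "real \<Rightarrow> (nat \<Rightarrow> real) \<Rightarrow> (nat \<Rightarrow> real) \<Rightarrow> ennreal" where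
  "seq_norm q w a = (\<Sum>n. ennreal (w (Suc n) * a (Suc n) powr q)) epowr (1 / q)"

definition adm_fun :: "real \<Rightarrow> (real \<Rightarrow> real) \<Rightarrow> (real \<Rightarrow> real) \<Rightarrow> bool" where
  "adm_fun p w f \<longleftrightarrow>
     f \<in> borel_measurable (lebesgue_on {0<..}) \<and> (\<forall>x>0. 0 \<le> f x) \<and>
     0 < fun_norm p w f \<and> fun_norm p w f < \<infinity>"

definition adm_seq :: "real \<Rightarrow> (nat \<Rightarrow> real) \<Rightarrow> (nat \<Rightarrow> real) \<Rightarrow> bool" where
  "adm_seq q w a \<longleftrightarrow>
     (\<forall>n\<ge>1. 0 \<le> a n) \<and> 0 < seq_norm q w a \<and> seq_norm q w a < \<infinity>"

definition best_possible :: "(real \<Rightarrow> bool) \<Rightarrow> real \<Rightarrow> bool" where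
  "best_possible P k \<longleftrightarrow> P k \<and> (\<forall>c<k. \<not> P c)"

end

theory Submission
  imports Defs
begin

text \<open>
  Write \<open>K(t) = csch (\<rho> t\<^sup>\<gamma>) exp (-\<alpha> t\<^sup>\<gamma>)\<close> and \<open>g(t) = K(t) t\<^bsup>\<sigma>-1\<^esup>\<close>, so that \<open>k(\<sigma>)\<close> is the
  integral of \<open>g\<close> over the half-line, and put \<open>y = U\<^sup>\<delta>(x)\<close>.  The kernel depends only on the product of
  \<open>y\<close> and \<open>V~\<^sub>n\<close>.  In the logarithmic measures \<open>dm = (\<mu>/U) dx\<close> on the half-line and
  \<open>w\<^sub>n = \<nu>\<^sub>n/V~\<^sub>n\<close> on the integers, with \<open>f\<close> and \<open>a\<close> rescaled accordingly
  (\<open>scaled_fun\<close>, \<open>scaled_seq\<close>), the weighted norms become plain \<open>L\<^sup>p\<close> and \<open>L\<^sup>q\<close> norms and the kernel becomes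
  \<open>G\<^sub>n(x) = (y V~\<^sub>n)\<^sup>\<sigma> K(y V~\<^sub>n)\<close>.  All three inequalities then assert that this one kernel has norm
  \<open>k(\<sigma>)\<close>.

  Upper bound.  The substitution \<open>t = y V~\<^sub>n\<close> satisfies \<open>|dt|/t = dm\<close>, so every \<open>G\<^sub>n\<close> has integral exactly
  \<open>k(\<sigma>)\<close>; here \<open>U(\<infinity>) = \<infinity>\<close> makes \<open>U\<close> a bijection of the half-line (\<open>nn_integral_powr_U\<close>).  In the other
  variable \<open>\<Sum>\<^sub>n w\<^sub>n G\<^sub>n(x)\<close> equals \<open>\<Sum>\<^sub>n y \<nu>\<^sub>n g(y V~\<^sub>n)\<close>.  Since \<open>V~\<^sub>n\<close> lies to the right of the midpoint of
  \<open>[V\<^bsub>n-1\<^esub>, V\<^sub>n]\<close> and \<open>g\<close> is decreasing and strictly midpoint convex (\<open>kern_powr_properties\<close>), each term is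
  smaller than the integral of \<open>g\<close> over the interval from \<open>y V\<^bsub>n-1\<^esub>\<close> to \<open>y V\<^sub>n\<close>, and the whole sum is smaller
  than \<open>k(\<sigma>)\<close> (\<open>sum_midpoints_less_integral\<close>).  A Schur test (locale \<open>schur_kernel\<close>) turns these two facts into the
  second and the third inequality, with the strict sign coming from the strict bound on the sum.  The
  first inequality follows from the second by the Hoelder inequality.

  Sharpness.  The Hoelder inequality also shows that a smaller constant in the second or third inequality would be
  admissible in the first, so only the first one has to be tested.  In rescaled form the test functions
  are \<open>F = y\<^bsup>\<epsilon>/p\<^esup>\<close> for \<open>y \<le> 1\<close> and \<open>A\<^sub>n = V~\<^sub>n\<^bsup>-\<epsilon>/q\<^esup>\<close> for \<open>n > N\<close>.  The integral of \<open>F\<^sup>p\<close> is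
  \<open>1/\<epsilon>\<close>.  The sum of \<open>A\<^sup>q\<close> is a Riemann sum for \<open>t\<^bsup>-1-\<epsilon>\<^esup>\<close> beyond \<open>V\<^sub>N\<close>; because \<open>\<nu>\<close> is
  eventually decreasing and \<open>V(\<infinity>) = \<infinity>\<close>, it is at least \<open>V\<^bsub>N+1\<^esub>\<^sup>-\<^sup>\<epsilon>/\<epsilon>\<close> (\<open>tail_sum_ge\<close>).  The bilinear form is at
  least \<open>\<tau>\<^bsup>\<epsilon>/p\<^esup>\<close> times the integral of \<open>g\<close> over \<open>[\<tau>, T]\<close> times the sum of \<open>A\<^sup>q\<close>, provided
  \<open>V~\<^sub>n \<ge> T\<close> for \<open>n > N\<close> (\<open>bilinear_form_test_ge\<close>).  Letting \<open>\<epsilon>\<close> tend to \<open>0\<close> for fixed \<open>\<tau>\<close> and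
  \<open>T\<close>, an admissible constant is at least the integral of \<open>g\<close> over \<open>[\<tau>, T]\<close>
  (\<open>truncated_integral_le\<close>), hence at least \<open>k(\<sigma>)\<close>.
\<close>

section \<open>Powers of extended nonnegative reals and the Hoelder inequality\<close>

lemma epowr_ennreal: "0 \<le> r \<Longrightarrow> ennreal r epowr s = ennreal (r powr s)"
  by (simp add: epowr_def)

lemma epowr_top [simp]: "top epowr s = top" "\<infinity> epowr s = \<infinity>"
  by (simp_all add: epowr_def)

lemma epowr_0 [simp]: "0 epowr s = 0"
  by (simp add: epowr_def)

lemma epowr_1 [simp]: "x epowr 1 = x"
  by (cases x) (auto simp: epowr_ennreal)

lemma epowr_eq_0_iff [simp]: "x epowr s = 0 \<longleftrightarrow> x = 0"
  by (cases x) (auto simp: epowr_ennreal)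

lemma epowr_eq_top_iff [simp]: "x epowr s = top \<longleftrightarrow> x = top"
  by (cases x) (auto simp: epowr_ennreal)

lemma epowr_mult: "(x * y) epowr s = x epowr s * y epowr s"
proof (cases "x = 0 \<or> y = 0")
  case False
  then show ?thesis
    by (cases x; cases y)
       (auto simp: epowr_ennreal powr_mult ennreal_top_mult ennreal_mult_top simp flip: ennreal_mult)
qed auto

lemma epowr_epowr: "(x epowr s) epowr t = x epowr (s * t)"
  by (cases x) (auto simp: epowr_ennreal powr_powr)

lemma epowr_add: "0 < s \<Longrightarrow> 0 < t \<Longrightarrow> x epowr (s + t) = x epowr s * x epowr t"
  by (cases x) (auto simp: epowr_ennreal powr_add ennreal_mult ennreal_top_mult)

lemma epowr_mono: "0 < s \<Longrightarrow> x \<le> y \<Longrightarrow> x epowr s \<le> y epowr s"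
  by (cases x; cases y) (auto simp: epowr_ennreal powr_mono2 ennreal_leI top_unique)

lemma epowr_less_iff:
  assumes "0 < s"
  shows "x epowr s < y epowr s \<longleftrightarrow> x < y"
proof
  assume "x epowr s < y epowr s"
  then show "x < y"
    using epowr_mono[OF assms, of y x] by (meson leD leI)
next
  assume "x < y"
  then have "x epowr s \<le> y epowr s"
    by (intro epowr_mono assms) simp
  moreover have "x epowr s \<noteq> y epowr s"
  proof
    assume "x epowr s = y epowr s"
    then have "(x epowr s) epowr (1 / s) = (y epowr s) epowr (1 / s)"
      by simp
    then show False
      using \<open>x < y\<close> assms by (simp add: epowr_epowr)
  qed
  ultimately show "x epowr s < y epowr s"
    by simp
qed

lemma measurable_epowr [measurable]:
  assumes [measurable]: "f \<in> borel_measurable M"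
  shows "(\<lambda>x. f x epowr s) \<in> borel_measurable M"
  unfolding epowr_def by measurable

text \<open>If one factor is infinite, so is the right-hand side; otherwise this is Young's inequality for reals.\<close>

lemma Young_ennreal:
  fixes x y :: ennreal
  assumes "p > 1" "q > 1" "1 / p + 1 / q = 1"
  shows "x * y \<le> ennreal (1 / p) * x epowr p + ennreal (1 / q) * y epowr q"
proof (cases "x = top \<or> y = top")
  case True
  then show ?thesis
    using assms by (auto simp: ennreal_mult_top)
next
  case False
  then show ?thesis
    using assms Youngs_inequality[of p q]
    by (cases x; cases y)
       (auto simp: epowr_ennreal divide_inverse mult.commute simp flip: ennreal_mult ennreal_plus intro!: ennreal_leI)
qed

text \<open>With both integrals on the right positive and finite, normalise them to \<open>1\<close> and integrate Young's
inequality; in the degenerate cases either the product vanishes almost everywhere or the right-hand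
side is infinite.\<close>

lemma nn_integral_Hoelder:
  fixes f g :: "'a \<Rightarrow> ennreal"
  assumes pq: "p > 1" "q > 1" "1 / p + 1 / q = 1"
    and [measurable]: "f \<in> borel_measurable M" "g \<in> borel_measurable M"
  shows "(\<integral>\<^sup>+x. f x * g x \<partial>M)
    \<le> (\<integral>\<^sup>+x. f x epowr p \<partial>M) epowr (1 / p) * (\<integral>\<^sup>+x. g x epowr q \<partial>M) epowr (1 / q)"
    (is "_ \<le> ?A epowr _ * ?B epowr _")
proof -
  consider "?A = 0 \<or> ?B = 0" | "?A \<noteq> 0" "?B \<noteq> 0" "?A = top \<or> ?B = top" | "?A \<noteq> 0" "?B \<noteq> 0" "?A \<noteq> top" "?B \<noteq> top"
    by auto
  then show ?thesis
  proof cases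
    case 1
    then have "AE x in M. f x * g x = 0"
      by (auto simp: nn_integral_0_iff_AE)
    then have "(\<integral>\<^sup>+x. f x * g x \<partial>M) = 0"
      by (simp add: nn_integral_0_iff_AE)
    then show ?thesis by simp
  next
    case 2
    then show ?thesis by (auto simp: ennreal_top_mult ennreal_mult_top)
  next
    case 3
    then obtain A B where A: "?A = ennreal A" "0 < A" and B: "?B = ennreal B" "0 < B"
      by (metis ennreal_cases ennreal_less_zero_iff zero_less_iff_neq_zero)
    define a where "a = A powr (1 / p)"
    define b where "b = B powr (1 / q)"
    have ab: "a > 0" "b > 0"
      using A B by (auto simp: a_def b_def)
    have eA: "?A epowr (1 / p) = ennreal a" and eB: "?B epowr (1 / q) = ennreal b"
      using A(2) B(2) unfolding A(1) B(1) by (simp_all add: a_def b_def epowr_ennreal)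
    have pw: "ennreal (1/a) epowr p = ennreal (1 / A)" "ennreal (1/b) epowr q = ennreal (1 / B)"
      using pq ab A(2) B(2) by (auto simp: epowr_ennreal powr_divide a_def b_def powr_powr)
    have "ennreal (1/a) * ennreal (1/b) * (\<integral>\<^sup>+x. f x * g x \<partial>M)
        = (\<integral>\<^sup>+x. (ennreal (1/a) * f x) * (ennreal (1/b) * g x) \<partial>M)"
      by (simp add: nn_integral_cmult[symmetric] ac_simps)
    also have "\<dots> \<le> (\<integral>\<^sup>+x. ennreal (1/p) * (ennreal (1/a) * f x) epowr p
                       + ennreal (1/q) * (ennreal (1/b) * g x) epowr q \<partial>M)"
      by (intro nn_integral_mono Young_ennreal pq)
    also have "\<dots> = ennreal (1/p) * (ennreal (1 / A) * ?A) + ennreal (1/q) * (ennreal (1 / B) * ?B)"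
      by (simp add: epowr_mult pw nn_integral_add nn_integral_cmult)
    also have "\<dots> = ennreal (1/p) + ennreal (1/q)"
      using A(2) B(2) unfolding A(1) B(1) by (simp flip: ennreal_mult)
    also have "\<dots> = 1"
      using pq by (simp flip: ennreal_plus)
    finally have *: "ennreal (1/a) * ennreal (1/b) * (\<integral>\<^sup>+x. f x * g x \<partial>M) \<le> 1" .
    have "(\<integral>\<^sup>+x. f x * g x \<partial>M) = ennreal a * ennreal b * (ennreal (1/a) * ennreal (1/b) * (\<integral>\<^sup>+x. f x * g x \<partial>M))"
      using ab by (simp add: mult.assoc[symmetric] flip: ennreal_mult)
    also have "\<dots> \<le> ennreal a * ennreal b * 1"
      by (intro mult_left_mono *) auto
    finally show ?thesis
      by (simp add: eA eB)
  qed
qed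

section \<open>A Schur test with strict inequality\<close>

text \<open>Jensen's inequality for the measure with density \<open>g\<close>, in unnormalised form: apply the Hoelder inequality
to \<open>g F = g\<^bsup>1/q\<^esup> (g\<^bsup>1/p\<^esup> F)\<close>.\<close>

lemma nn_integral_weighted_power:
  fixes g F :: "'a \<Rightarrow> ennreal"
  assumes p: "p > 1" and [measurable]: "g \<in> borel_measurable M" "F \<in> borel_measurable M"
  shows "(\<integral>\<^sup>+x. g x * F x \<partial>M) epowr p \<le> (\<integral>\<^sup>+x. g x \<partial>M) epowr (p - 1) * (\<integral>\<^sup>+x. g x * F x epowr p \<partial>M)"
proof -
  define q where "q = p / (p - 1)"
  have q: "q > 1" "1 / q + 1 / p = 1" "1 / p + 1 / q = 1"
    using p by (auto simp: q_def field_simps)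
  have g: "g x = g x epowr (1 / q) * g x epowr (1 / p)" for x
    using epowr_add[of "1 / q" "1 / p" "g x"] p q by simp
  have "(\<integral>\<^sup>+x. g x * F x \<partial>M) = (\<integral>\<^sup>+x. g x epowr (1 / q) * (g x epowr (1 / p) * F x) \<partial>M)"
    by (subst g) (simp add: mult.assoc)
  also have "\<dots> \<le> (\<integral>\<^sup>+x. (g x epowr (1 / q)) epowr q \<partial>M) epowr (1 / q)
      * (\<integral>\<^sup>+x. (g x epowr (1 / p) * F x) epowr p \<partial>M) epowr (1 / p)"
    using p q by (intro nn_integral_Hoelder) auto
  also have "\<dots> = (\<integral>\<^sup>+x. g x \<partial>M) epowr (1 / q) * (\<integral>\<^sup>+x. g x * F x epowr p \<partial>M) epowr (1 / p)"
    using p q by (simp add: epowr_mult epowr_epowr)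
  finally have "(\<integral>\<^sup>+x. g x * F x \<partial>M) epowr p
      \<le> ((\<integral>\<^sup>+x. g x \<partial>M) epowr (1 / q) * (\<integral>\<^sup>+x. g x * F x epowr p \<partial>M) epowr (1 / p)) epowr p"
    using p by (intro epowr_mono) auto
  also have "\<dots> = (\<integral>\<^sup>+x. g x \<partial>M) epowr (p - 1) * (\<integral>\<^sup>+x. g x * F x epowr p \<partial>M)"
    using p by (simp add: epowr_mult epowr_epowr q_def)
  finally show ?thesis .
qed

text \<open>The kernel has total mass \<open>\<kappa>\<close> in one variable and mass strictly below \<open>\<kappa>\<close> in the other.  The strict
bound is what makes the norm inequalities below strict.\<close>

locale schur_kernel =
  fixes m :: "'a measure" and w :: "nat \<Rightarrow> ennreal" and G :: "nat \<Rightarrow> 'a \<Rightarrow> ennreal" and \<kappa> :: ennreal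
  assumes G_meas [measurable]: "\<And>n. G n \<in> borel_measurable m"
    and \<kappa>_pos: "0 < \<kappa>" and \<kappa>: "\<kappa> < top"
    and integral_G: "\<And>n. (\<integral>\<^sup>+x. G n x \<partial>m) = \<kappa>"
    and sum_G: "\<And>x. x \<in> space m \<Longrightarrow> (\<Sum>n. w n * G n x) < \<kappa>"
begin

lemma integral_sum_G:
  assumes [measurable]: "h \<in> borel_measurable m"
  shows "(\<integral>\<^sup>+x. (\<Sum>n. w n * G n x) * h x \<partial>m) = (\<Sum>n. w n * (\<integral>\<^sup>+x. G n x * h x \<partial>m))"
proof -
  have "(\<integral>\<^sup>+x. (\<Sum>n. w n * G n x) * h x \<partial>m) = (\<integral>\<^sup>+x. (\<Sum>n. w n * (G n x * h x)) \<partial>m)"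
    by (simp flip: mult.assoc)
  also have "\<dots> = (\<Sum>n. \<integral>\<^sup>+x. w n * (G n x * h x) \<partial>m)"
    by (rule nn_integral_suminf) auto
  also have "\<dots> = (\<Sum>n. w n * (\<integral>\<^sup>+x. G n x * h x \<partial>m))"
    by (simp add: nn_integral_cmult)
  finally show ?thesis .
qed

text \<open>Apply Jensen's inequality to each inner integral, where the mass of the kernel is \<open>\<kappa>\<close>, and exchange sum and
integral.  This leaves the integral of \<open>F\<^sup>p\<close> against the mass in the other variable, which is
below \<open>\<kappa>\<close> everywhere; since \<open>F\<close> does not vanish almost everywhere, the inequality of the integrals is strict.\<close>

lemma sum_integral_power_less:
  assumes p: "p > 1" and [measurable]: "F \<in> borel_measurable m"
    and F: "\<And>x. x \<in> space m \<Longrightarrow> F x < top"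
    and pos: "0 < (\<integral>\<^sup>+x. F x epowr p \<partial>m)" and fin: "(\<integral>\<^sup>+x. F x epowr p \<partial>m) < top"
  shows "(\<Sum>n. w n * (\<integral>\<^sup>+x. G n x * F x \<partial>m) epowr p) epowr (1 / p)
    < \<kappa> * (\<integral>\<^sup>+x. F x epowr p \<partial>m) epowr (1 / p)"
proof -
  have "(\<Sum>n. w n * (\<integral>\<^sup>+x. G n x * F x \<partial>m) epowr p)
      \<le> (\<Sum>n. w n * (\<kappa> epowr (p - 1) * (\<integral>\<^sup>+x. G n x * F x epowr p \<partial>m)))"
    using nn_integral_weighted_power[OF p, of "G _" m F]
    by (intro suminf_le mult_left_mono) (auto simp: integral_G)
  also have "\<dots> = \<kappa> epowr (p - 1) * (\<integral>\<^sup>+x. (\<Sum>n. w n * G n x) * F x epowr p \<partial>m)"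
    by (simp add: integral_sum_G mult.left_commute[of _ "\<kappa> epowr _"])
  also have "\<dots> < \<kappa> epowr (p - 1) * (\<integral>\<^sup>+x. \<kappa> * F x epowr p \<partial>m)"
  proof (intro ennreal_mult_strict_left_mono)
    show "(\<integral>\<^sup>+x. (\<Sum>n. w n * G n x) * F x epowr p \<partial>m) < (\<integral>\<^sup>+x. \<kappa> * F x epowr p \<partial>m)"
    proof (rule nn_integral_less)
    have le: "(\<Sum>n. w n * G n x) * F x epowr p \<le> \<kappa> * F x epowr p" if "x \<in> space m" for x
      using sum_G[OF that] by (intro mult_right_mono) auto
    then show "AE x in m. (\<Sum>n. w n * G n x) * F x epowr p \<le> \<kappa> * F x epowr p"
      by simp
    have "(\<integral>\<^sup>+x. (\<Sum>n. w n * G n x) * F x epowr p \<partial>m) \<le> (\<integral>\<^sup>+x. \<kappa> * F x epowr p \<partial>m)"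
      by (intro nn_integral_mono le)
    also have "\<dots> < top"
      using fin \<kappa> by (simp add: nn_integral_cmult ennreal_mult_less_top)
    finally show "(\<integral>\<^sup>+x. (\<Sum>n. w n * G n x) * F x epowr p \<partial>m) \<noteq> \<infinity>"
      by simp
    show "\<not> (AE x in m. \<kappa> * F x epowr p \<le> (\<Sum>n. w n * G n x) * F x epowr p)"
    proof
      assume "AE x in m. \<kappa> * F x epowr p \<le> (\<Sum>n. w n * G n x) * F x epowr p"
      then have "AE x in m. F x epowr p = 0"
      proof (rule AE_mp, intro AE_I2 impI)
        fix x assume x: "x \<in> space m" and le: "\<kappa> * F x epowr p \<le> (\<Sum>n. w n * G n x) * F x epowr p"
        show "F x epowr p = 0"
        proof (rule ccontr)
          assume "F x epowr p \<noteq> 0"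
          then have "(\<Sum>n. w n * G n x) * F x epowr p < \<kappa> * F x epowr p"
            using sum_G[OF x] F[OF x]
              by (intro ennreal_mult_strict_right_mono) (auto simp: less_top[symmetric] zero_less_iff_neq_zero)
          with le show False by simp
        qed
      qed
      with pos show False
        by (simp add: nn_integral_0_iff_AE zero_less_iff_neq_zero)
    qed
    qed auto
  qed (use \<kappa> \<kappa>_pos in \<open>auto simp: zero_less_iff_neq_zero less_top[symmetric]\<close>)
  also have "\<dots> = \<kappa> epowr (p - 1) * (\<kappa> * (\<integral>\<^sup>+x. F x epowr p \<partial>m))"
    by (simp add: nn_integral_cmult)
  also have "\<dots> = (\<kappa> * (\<integral>\<^sup>+x. F x epowr p \<partial>m) epowr (1 / p)) epowr p"
    using p epowr_add[of "p - 1" 1 \<kappa>] by (simp add: epowr_mult epowr_epowr mult.assoc)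
  finally have "(\<Sum>n. w n * (\<integral>\<^sup>+x. G n x * F x \<partial>m) epowr p) epowr (1 / p)
      < ((\<kappa> * (\<integral>\<^sup>+x. F x epowr p \<partial>m) epowr (1 / p)) epowr p) epowr (1 / p)"
    using p by (subst epowr_less_iff) auto
  then show ?thesis
    using p by (simp add: epowr_epowr)
qed

text \<open>Now Jensen's inequality is applied to the inner sum, where the mass is below \<open>\<kappa>\<close>.  The
factor \<open>S\<close> that remains has integral \<open>\<kappa> \<Sum>\<^sub>n w\<^sub>n A\<^sub>n\<^sup>q > 0\<close>, so it does not vanish almost everywhere, and
replacing the mass by \<open>\<kappa>\<close> strictly increases the integral.\<close>

lemma integral_sum_power_less:
  assumes q: "q > 1" and A: "\<And>n. A n < top"
    and pos: "0 < (\<Sum>n. w n * A n epowr q)" and fin: "(\<Sum>n. w n * A n epowr q) < top"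
  shows "(\<integral>\<^sup>+x. (\<Sum>n. w n * G n x * A n) epowr q \<partial>m) epowr (1 / q)
    < \<kappa> * (\<Sum>n. w n * A n epowr q) epowr (1 / q)"
proof -
  define S where "S x = (\<Sum>n. w n * G n x * A n epowr q)" for x
  have [measurable]: "S \<in> borel_measurable m"
    unfolding S_def by measurable
  have int_S: "(\<integral>\<^sup>+x. S x \<partial>m) = \<kappa> * (\<Sum>n. w n * A n epowr q)"
  proof -
    have "(\<integral>\<^sup>+x. S x \<partial>m) = (\<Sum>n. \<integral>\<^sup>+x. w n * G n x * A n epowr q \<partial>m)"
      unfolding S_def by (rule nn_integral_suminf) auto
    also have "\<dots> = (\<Sum>n. \<kappa> * (w n * A n epowr q))"
      by (simp add: nn_integral_cmult nn_integral_multc integral_G mult_ac del: ennreal_suminf_cmult)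
    finally show ?thesis by simp
  qed
  have S_pos: "0 < (\<integral>\<^sup>+x. S x \<partial>m)" and S_fin: "(\<integral>\<^sup>+x. S x \<partial>m) < top"
    using pos fin \<kappa> \<kappa>_pos by (auto simp: int_S ennreal_zero_less_mult_iff ennreal_mult_less_top)
  have "(\<integral>\<^sup>+x. (\<Sum>n. w n * G n x * A n) epowr q \<partial>m)
      \<le> (\<integral>\<^sup>+x. (\<Sum>n. w n * G n x) epowr (q - 1) * S x \<partial>m)"
    using nn_integral_weighted_power[OF q, of "\<lambda>n. w n * G n _" "count_space UNIV" A]
    by (intro nn_integral_mono) (simp add: nn_integral_count_space_nat S_def)
  also have "\<dots> < (\<integral>\<^sup>+x. \<kappa> epowr (q - 1) * S x \<partial>m)"
  proof (rule nn_integral_less)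
    have lt: "(\<Sum>n. w n * G n x) epowr (q - 1) < \<kappa> epowr (q - 1)" if "x \<in> space m" for x
      using sum_G[OF that] q by (simp add: epowr_less_iff)
    then show "AE x in m. (\<Sum>n. w n * G n x) epowr (q - 1) * S x \<le> \<kappa> epowr (q - 1) * S x"
      by (intro AE_I2 mult_right_mono) (auto intro: less_imp_le)
    have "(\<integral>\<^sup>+x. (\<Sum>n. w n * G n x) epowr (q - 1) * S x \<partial>m) \<le> (\<integral>\<^sup>+x. \<kappa> epowr (q - 1) * S x \<partial>m)"
      using lt by (intro nn_integral_mono mult_right_mono) (auto intro: less_imp_le)
    also have "\<dots> < top"
      using S_fin \<kappa> by (auto simp: nn_integral_cmult ennreal_mult_eq_top_iff less_top[symmetric])
    finally show "(\<integral>\<^sup>+x. (\<Sum>n. w n * G n x) epowr (q - 1) * S x \<partial>m) \<noteq> \<infinity>"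
      by simp
    show "\<not> (AE x in m. \<kappa> epowr (q - 1) * S x \<le> (\<Sum>n. w n * G n x) epowr (q - 1) * S x)"
    proof
      assume "AE x in m. \<kappa> epowr (q - 1) * S x \<le> (\<Sum>n. w n * G n x) epowr (q - 1) * S x"
      moreover have "AE x in m. S x \<noteq> \<infinity>"
        using S_fin by (intro nn_integral_PInf_AE) auto
      ultimately have "AE x in m. S x = 0"
        using AE_space
      proof eventually_elim
        case (elim x)
        show "S x = 0"
        proof (rule ccontr)
          assume "S x \<noteq> 0"
          then have "(\<Sum>n. w n * G n x) epowr (q - 1) * S x < \<kappa> epowr (q - 1) * S x"
            using lt elim by (intro ennreal_mult_strict_right_mono) (auto simp: less_top zero_less_iff_neq_zero)
          with elim show False by simp
        qed
      qed
      with S_pos show False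
        by (simp add: nn_integral_0_iff_AE zero_less_iff_neq_zero)
    qed
  qed auto
  also have "\<dots> = (\<kappa> * (\<Sum>n. w n * A n epowr q) epowr (1 / q)) epowr q"
    using q epowr_add[of "q - 1" 1 \<kappa>] by (simp add: nn_integral_cmult int_S epowr_mult epowr_epowr mult.assoc)
  finally have "(\<integral>\<^sup>+x. (\<Sum>n. w n * G n x * A n) epowr q \<partial>m) epowr (1 / q)
      < ((\<kappa> * (\<Sum>n. w n * A n epowr q) epowr (1 / q)) epowr q) epowr (1 / q)"
    using q by (subst epowr_less_iff) auto
  then show ?thesis
    using q by (simp add: epowr_epowr)
qed

end

section \<open>Midpoint convexity of the kernel\<close>

text \<open>Products of decreasing midpoint convex functions are midpoint convex: half the sum of the products
exceeds the product of the averages by \<open>(a1 - a2) (b1 - b2) / 4\<close>.\<close>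

lemma midpoint_mult_le:
  fixes a1 a2 am b1 b2 bm :: real
  assumes "am \<le> (a1 + a2) / 2" "bm \<le> (b1 + b2) / 2" "a2 \<le> a1" "b2 \<le> b1" "0 \<le> am" "0 \<le> bm"
  shows "am * bm \<le> (a1 * b1 + a2 * b2) / 2"
proof -
  have "am * bm \<le> ((a1 + a2) / 2) * ((b1 + b2) / 2)"
    using assms by (intro mult_mono) auto
  also have "\<dots> \<le> (a1 * b1 + a2 * b2) / 2"
    using mult_nonneg_nonneg[of "a1 - a2" "b1 - b2"] assms by (simp add: field_simps)
  finally show ?thesis .
qed

lemma midpoint_mult_less:
  fixes a1 a2 am b1 b2 bm :: real
  assumes "am \<le> (a1 + a2) / 2" "bm \<le> (b1 + b2) / 2" "a2 < a1" "b2 < b1" "0 \<le> am" "0 \<le> bm"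
  shows "am * bm < (a1 * b1 + a2 * b2) / 2"
proof -
  have "am * bm \<le> ((a1 + a2) / 2) * ((b1 + b2) / 2)"
    using assms by (intro mult_mono) auto
  also have "\<dots> < (a1 * b1 + a2 * b2) / 2"
    using mult_pos_pos[of "a1 - a2" "b1 - b2"] assms by (simp add: field_simps)
  finally show ?thesis .
qed

text \<open>Weighted arithmetic-geometric mean, applied to \<open>x / m\<close> and \<open>y / m\<close> with \<open>m\<close> the midpoint.\<close>

lemma powr_midpoint_ge:
  fixes x y :: real
  assumes "0 < x" "0 < y" "0 \<le> \<gamma>" "\<gamma> \<le> 1"
  shows "(x powr \<gamma> + y powr \<gamma>) / 2 \<le> ((x + y) / 2) powr \<gamma>"
proof -
  define m where "m = (x + y) / 2"
  have m: "m > 0" using assms by (simp add: m_def)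
  have "(x / m) powr \<gamma> \<le> \<gamma> * (x / m) + (1 - \<gamma>)" "(y / m) powr \<gamma> \<le> \<gamma> * (y / m) + (1 - \<gamma>)"
    using Youngs_inequality_0[of \<gamma> "1 - \<gamma>" "x / m" 1] Youngs_inequality_0[of \<gamma> "1 - \<gamma>" "y / m" 1] assms m by auto
  then have "(x / m) powr \<gamma> + (y / m) powr \<gamma> \<le> \<gamma> * ((x + y) / m) + 2 * (1 - \<gamma>)"
    by (simp add: algebra_simps add_divide_distrib)
  also have "(x + y) / m = 2"
    using m by (simp add: m_def divide_eq_eq)
  finally have "(x powr \<gamma> + y powr \<gamma>) / m powr \<gamma> \<le> 2"
    using assms m by (simp add: powr_divide add_divide_distrib)
  then show ?thesis
    using m by (simp add: m_def[symmetric] field_simps)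
qed

lemma exp_midpoint_le: "exp ((u + v) / 2) \<le> (exp u + exp v) / 2" for u v :: real
  using Youngs_inequality_0[of "1/2" "1/2" "exp u" "exp v"]
  by (simp add: exp_powr_real add_divide_distrib flip: exp_add)

lemma exp_powr_midpoint_le:
  fixes x y :: real
  assumes "0 < x" "0 < y" "0 \<le> \<gamma>" "\<gamma> \<le> 1" "0 \<le> c"
  shows "exp (- c * ((x + y) / 2) powr \<gamma>) \<le> (exp (- c * x powr \<gamma>) + exp (- c * y powr \<gamma>)) / 2"
proof -
  have "exp (- c * ((x + y) / 2) powr \<gamma>) \<le> exp (- c * ((x powr \<gamma> + y powr \<gamma>) / 2))"
    using mult_left_mono[OF powr_midpoint_ge[of x y \<gamma>], of c] assms by simp
  also have "\<dots> = exp ((- c * x powr \<gamma> + - c * y powr \<gamma>) / 2)"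
    by (simp add: field_simps)
  also have "\<dots> \<le> (exp (- c * x powr \<gamma>) + exp (- c * y powr \<gamma>)) / 2"
    by (rule exp_midpoint_le)
  finally show ?thesis .
qed

text \<open>The arithmetic mean dominates the geometric one, a negative power reverses this, and a second use of
the same inequality bounds the geometric mean of the powers.\<close>

lemma powr_nonpos_midpoint_le:
  fixes x y :: real
  assumes "0 < x" "0 < y" "s \<le> 0"
  shows "((x + y) / 2) powr s \<le> (x powr s + y powr s) / 2"
proof -
  have "((x + y) / 2) powr s \<le> (x powr (1/2) * y powr (1/2)) powr s"
    using Youngs_inequality_0[of "1/2" "1/2" x y] assms by (intro powr_mono2') auto
  also have "\<dots> = (x powr s) powr (1/2) * (y powr s) powr (1/2)"
    using assms by (simp add: powr_mult powr_powr)
  also have "\<dots> \<le> (x powr s + y powr s) / 2"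
    using Youngs_inequality_0[of "1/2" "1/2" "x powr s" "y powr s"] assms by simp
  finally show ?thesis .
qed

lemma inverse_midpoint_le:
  fixes a b m :: real
  assumes "0 < a" "0 < b" "(a + b) / 2 \<le> m"
  shows "1 / m \<le> (1 / a + 1 / b) / 2"
proof -
  have "1 / m \<le> 1 / ((a + b) / 2)"
    using assms by (intro divide_left_mono) auto
  also have "\<dots> \<le> (1 / a + 1 / b) / 2"
  proof -
    have "(1 / a + 1 / b) / 2 - 1 / ((a + b) / 2) = (a - b)^2 / (2 * a * b * (a + b))"
      using assms by (simp add: divide_simps power2_eq_square) (simp add: algebra_simps)
    also have "\<dots> \<ge> 0"
      using assms by simp
    finally show ?thesis by simp
  qed
  finally show ?thesis .
qed

definition kern :: "real \<Rightarrow> real \<Rightarrow> real \<Rightarrow> real \<Rightarrow> real" where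
  "kern \<alpha> \<rho> \<gamma> t = csch (\<rho> * t powr \<gamma>) / exp (\<alpha> * t powr \<gamma>)"

lemma measurable_kern [measurable]: "kern \<alpha> \<rho> \<gamma> \<in> borel_measurable borel"
  unfolding kern_def[abs_def] csch_def by measurable

lemma kern_nonneg: "0 < \<rho> \<Longrightarrow> 0 \<le> kern \<alpha> \<rho> \<gamma> t"
  by (simp add: kern_def csch_def)

text \<open>Pulling \<open>exp (\<rho> t\<^sup>\<gamma>)\<close> out of the hyperbolic sine displays the kernel as a product of two strictly
decreasing midpoint convex functions, as \<open>midpoint_mult_less\<close> requires.  The factor \<open>exp (-\<alpha> t\<^sup>\<gamma>)\<close> is
constant for \<open>\<alpha> = 0\<close> and becomes strictly decreasing only together with \<open>exp (-\<rho> t\<^sup>\<gamma>)\<close>.\<close>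

lemma kern_factorization:
  assumes "0 < \<rho>" "0 < t"
  shows "kern \<alpha> \<rho> \<gamma> t = 2 * exp (- (\<rho> + \<alpha>) * t powr \<gamma>) * (1 / (1 - exp (- (2 * \<rho>) * t powr \<gamma>)))"
proof -
  define u where "u = t powr \<gamma>"
  have u: "u > 0" using assms by (simp add: u_def)
  have e: "exp (\<rho> * u) - exp (- (\<rho> * u)) = exp (\<rho> * u) * (1 - exp (- (2 * \<rho>) * u))"
    by (simp add: algebra_simps exp_add[symmetric])
  have "exp (- (\<rho> + \<alpha>) * u) = 1 / (exp (\<rho> * u) * exp (\<alpha> * u))"
    using exp_minus[of "\<rho> * u + \<alpha> * u"] by (simp add: exp_add inverse_eq_divide ring_distribs)
  then show ?thesis
    unfolding kern_def csch_def u_def[symmetric] e by simp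
qed

text \<open>With \<open>A = 2 exp (-(\<rho> + \<alpha>) t\<^sup>\<gamma>)\<close>, \<open>C = 1 / (1 - exp (-2 \<rho> t\<^sup>\<gamma>))\<close> and \<open>D = t\<^bsup>\<sigma>-1\<^esup>\<close>, both \<open>A\<close> and
\<open>C D\<close> are positive, strictly decreasing and midpoint convex.  Convexity of \<open>A\<close> and \<open>C\<close> rests on the concavity
of \<open>t\<^sup>\<gamma>\<close>, that is on \<open>\<gamma> \<le> 1\<close>, and that of \<open>D\<close> on \<open>\<sigma> \<le> 1\<close>.\<close>

lemma kern_powr_properties:
  assumes "0 \<le> \<alpha>" "0 < \<rho>" "0 < \<gamma>" "\<gamma> \<le> 1" "\<sigma> \<le> 1" "0 < x" "x < y"
  shows kern_powr_midpoint_less: "2 * (kern \<alpha> \<rho> \<gamma> ((x + y) / 2) * ((x + y) / 2) powr (\<sigma> - 1))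
      < kern \<alpha> \<rho> \<gamma> x * x powr (\<sigma> - 1) + kern \<alpha> \<rho> \<gamma> y * y powr (\<sigma> - 1)"
    and kern_powr_decreasing: "kern \<alpha> \<rho> \<gamma> y * y powr (\<sigma> - 1) < kern \<alpha> \<rho> \<gamma> x * x powr (\<sigma> - 1)"
proof -
  define A where "A t = 2 * exp (- (\<rho> + \<alpha>) * t powr \<gamma>)" for t
  define C where "C t = 1 / (1 - exp (- (2 * \<rho>) * t powr \<gamma>))" for t
  define D where "D t = t powr (\<sigma> - 1)" for t :: real
  define z where "z = (x + y) / 2"
  have xyz: "0 < x" "0 < y" "0 < z" using assms by (auto simp: z_def)
  have g: "kern \<alpha> \<rho> \<gamma> t * t powr (\<sigma> - 1) = A t * (C t * D t)" if "0 < t" for t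
    using kern_factorization[of \<rho> t] that assms by (simp add: A_def C_def D_def)
  have pow: "x powr \<gamma> < y powr \<gamma>"
    using assms by (intro powr_less_mono2) auto
  have lt1: "exp (- (2 * \<rho>) * t powr \<gamma>) < 1" if "0 < t" for t
    using that assms by simp
  have A: "A y < A x" "A z \<le> (A x + A y) / 2"
  proof -
    show "A y < A x"
      using pow assms by (simp add: A_def)
    show "A z \<le> (A x + A y) / 2"
      using exp_powr_midpoint_le[of x y \<gamma> "\<rho> + \<alpha>"] assms unfolding A_def z_def by simp
  qed
  have C_less: "C y < C x"
  proof -
    have "exp (- (2 * \<rho>) * y powr \<gamma>) < exp (- (2 * \<rho>) * x powr \<gamma>)"
      using pow assms by simp
    then show ?thesis
      using lt1[OF xyz(1)] lt1[OF xyz(2)] unfolding C_def by (intro divide_strict_left_mono mult_pos_pos) auto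
  qed
  have C_mid: "C z \<le> (C x + C y) / 2"
  proof -
    define E where "E t = exp (- (2 * \<rho>) * t powr \<gamma>)" for t
    have "E z \<le> (E x + E y) / 2"
      unfolding E_def z_def using assms by (intro exp_powr_midpoint_le) auto
    moreover have "E x < 1" "E y < 1"
      using lt1 xyz by (auto simp: E_def)
    ultimately show ?thesis
      unfolding C_def E_def[symmetric] by (intro inverse_midpoint_le) (auto simp: field_simps)
  qed
  have D: "D y \<le> D x" "D z \<le> (D x + D y) / 2"
    using assms powr_nonpos_midpoint_le[of x y "\<sigma> - 1"] by (auto simp: D_def z_def intro!: powr_mono2')
  have pos: "0 < A t" "0 < C t" "0 < D t" if "0 < t" for t
    using lt1[OF that] that by (auto simp: A_def C_def D_def)
  note pos' = pos[OF xyz(1)] pos[OF xyz(2)] pos[OF xyz(3)]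
  note nonneg = pos'[THEN less_imp_le]
  have CD_less: "C y * D y < C x * D x"
    by (rule mult_less_le_imp_less) (use C_less D pos' nonneg in simp_all)
  have CD_mid: "C z * D z \<le> (C x * D x + C y * D y) / 2"
    by (rule midpoint_mult_le) (use C_less C_mid D pos' nonneg in simp_all)
  have "A y * (C y * D y) < A x * (C x * D x)"
    by (rule mult_strict_mono) (use A CD_less pos' nonneg in simp_all)
  then show "kern \<alpha> \<rho> \<gamma> y * y powr (\<sigma> - 1) < kern \<alpha> \<rho> \<gamma> x * x powr (\<sigma> - 1)"
    using xyz by (simp add: g)
  have "A z * (C z * D z) < (A x * (C x * D x) + A y * (C y * D y)) / 2"
    by (rule midpoint_mult_less) (use A CD_less CD_mid pos' nonneg in simp_all)
  then show "2 * (kern \<alpha> \<rho> \<gamma> ((x + y) / 2) * ((x + y) / 2) powr (\<sigma> - 1))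
      < kern \<alpha> \<rho> \<gamma> x * x powr (\<sigma> - 1) + kern \<alpha> \<rho> \<gamma> y * y powr (\<sigma> - 1)"
    using xyz by (simp add: g z_def[symmetric])
qed

section \<open>Midpoint sums against integrals\<close>

text \<open>Reflecting \<open>x\<close> to \<open>a + b - x\<close> shows that twice the integral is the integral of
\<open>g(x) + g(a + b - x)\<close>, which exceeds \<open>2 g((a + b) / 2)\<close> except at the midpoint.\<close>

lemma midpoint_less_integral:
  fixes g :: "real \<Rightarrow> real"
  assumes [measurable]: "g \<in> borel_measurable borel"
    and nonneg: "\<And>x. 0 < x \<Longrightarrow> 0 \<le> g x"
    and mid: "\<And>x y. 0 < x \<Longrightarrow> x < y \<Longrightarrow> 2 * g ((x + y) / 2) < g x + g y"
    and ab: "0 \<le> a" "a < b"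
  shows "ennreal ((b - a) * g ((a + b) / 2)) < (\<integral>\<^sup>+x\<in>{a<..<b}. ennreal (g x) \<partial>lborel)"
proof -
  let ?m = "(a + b) / 2"
  let ?I = "\<integral>\<^sup>+x\<in>{a<..<b}. ennreal (g x) \<partial>lborel"
  have "?I = (\<integral>\<^sup>+x. ennreal (g (a + b - x)) * indicator {a<..<b} (a + b - x) \<partial>lborel)"
    using nn_integral_real_affine[of "\<lambda>x. ennreal (g x) * indicator {a<..<b} x" "-1" "a + b"] by simp
  also have "\<dots> = (\<integral>\<^sup>+x\<in>{a<..<b}. ennreal (g (a + b - x)) \<partial>lborel)"
    by (intro nn_integral_cong) (auto split: split_indicator)
  finally have "?I + ?I = (\<integral>\<^sup>+x. ennreal (g x) * indicator {a<..<b} x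
      + ennreal (g (a + b - x)) * indicator {a<..<b} x \<partial>lborel)"
    by (subst nn_integral_add) auto
  also have "\<dots> = (\<integral>\<^sup>+x\<in>{a<..<b}. ennreal (g x + g (a + b - x)) \<partial>lborel)"
    using ab by (intro nn_integral_cong) (auto split: split_indicator simp: ennreal_plus nonneg)
  finally have 1: "?I + ?I = \<dots>" .
  have mid': "2 * g ?m < g x + g (a + b - x)" if "x \<in> {a<..<b}" "x \<noteq> ?m" for x
    using mid[of x "a + b - x"] mid[of "a + b - x" x] that ab by (cases "x < a + b - x") auto
  have "(\<integral>\<^sup>+x\<in>{a<..<b}. ennreal (2 * g ?m) \<partial>lborel) < (\<integral>\<^sup>+x\<in>{a<..<b}. ennreal (g x + g (a + b - x)) \<partial>lborel)"
  proof (rule nn_integral_less)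
    show "(\<integral>\<^sup>+x\<in>{a<..<b}. ennreal (2 * g ?m) \<partial>lborel) \<noteq> \<infinity>"
      using ab by (simp add: nn_integral_cmult_indicator ennreal_mult_eq_top_iff)
    have "2 * g ?m \<le> g x + g (a + b - x)" if "x \<in> {a<..<b}" for x
    proof (cases "x = ?m")
      case True
      then have *: "a + b - x = x" by (simp add: field_simps)
      show ?thesis unfolding * unfolding True by simp
    qed (use mid'[OF that] in auto)
    then show "AE x in lborel. ennreal (2 * g ?m) * indicator {a<..<b} x
        \<le> ennreal (g x + g (a + b - x)) * indicator {a<..<b} x"
      by (intro AE_I2) (auto split: split_indicator intro!: ennreal_leI)
    show "\<not> (AE x in lborel. ennreal (g x + g (a + b - x)) * indicator {a<..<b} x
        \<le> ennreal (2 * g ?m) * indicator {a<..<b} x)"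
    proof
      assume "AE x in lborel. ennreal (g x + g (a + b - x)) * indicator {a<..<b} x
        \<le> ennreal (2 * g ?m) * indicator {a<..<b} x"
      moreover have "AE x in lborel. x \<noteq> ?m"
        by (rule AE_lborel_singleton)
      ultimately have "AE x in lborel. x \<notin> {a<..<b}"
      proof eventually_elim
        case (elim x)
        show ?case
        proof
          assume x: "x \<in> {a<..<b}"
          with elim have "ennreal (g x + g (a + b - x)) \<le> ennreal (2 * g ?m)" by simp
          with nonneg[of ?m] ab have "g x + g (a + b - x) \<le> 2 * g ?m" by (subst (asm) ennreal_le_iff) auto
          with mid'[OF x] elim show False by simp
        qed
      qed
      then have "emeasure lborel {a<..<b} = 0"
        by (subst (asm) AE_iff_measurable[of "{a<..<b}"]) auto
      with ab show False by simp
    qed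
  qed auto
  also have "(\<integral>\<^sup>+x\<in>{a<..<b}. ennreal (2 * g ?m) \<partial>lborel) = ennreal ((b - a) * g ?m) + ennreal ((b - a) * g ?m)"
    using ab nonneg[of ?m]
    by (simp add: nn_integral_cmult_indicator ennreal_mult[symmetric] ennreal_plus[symmetric] del: ennreal_plus)
  finally have "ennreal ((b - a) * g ?m) + ennreal ((b - a) * g ?m) < ?I + ?I"
    by (simp only: 1)
  then have *: "\<not> ?I + ?I \<le> ennreal ((b - a) * g ?m) + ennreal ((b - a) * g ?m)"
    by (simp only: not_le)
  show ?thesis
  proof (rule ccontr)
    assume "\<not> ennreal ((b - a) * g ?m) < ?I"
    then have "?I \<le> ennreal ((b - a) * g ?m)"
      by (rule leI)
    then show False
      using * by (auto intro: add_mono)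
  qed
qed

text \<open>Each term is below the integral over its own interval: moving from the midpoint to \<open>v n\<close> only lowers
\<open>g\<close>.  The intervals are disjoint subsets of the half-line.\<close>

lemma sum_midpoints_less_integral:
  fixes g :: "real \<Rightarrow> real" and V v :: "nat \<Rightarrow> real"
  assumes [measurable]: "g \<in> borel_measurable borel"
    and nonneg: "\<And>x. 0 < x \<Longrightarrow> 0 \<le> g x"
    and mid: "\<And>x y. 0 < x \<Longrightarrow> x < y \<Longrightarrow> 2 * g ((x + y) / 2) < g x + g y"
    and decr: "\<And>x y. 0 < x \<Longrightarrow> x \<le> y \<Longrightarrow> g y \<le> g x"
    and fin: "(\<integral>\<^sup>+x\<in>{0<..}. ennreal (g x) \<partial>lborel) < top"
    and V: "0 \<le> V 0" "\<And>n. V n < V (Suc n)" and v: "\<And>n. (V n + V (Suc n)) / 2 \<le> v n"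
  shows "(\<Sum>n. ennreal ((V (Suc n) - V n) * g (v n))) < (\<integral>\<^sup>+x\<in>{0<..}. ennreal (g x) \<partial>lborel)"
proof -
  have mono: "V m \<le> V n" if "m \<le> n" for m n
    by (rule lift_Suc_mono_le[of V, OF less_imp_le[OF V(2)] that])
  have Vn: "0 \<le> V n" for n
    using V(1) mono[of 0 n] by simp
  define J where "J n = {V n<..<V (Suc n)}" for n
  have disj: "disjoint_family J"
    unfolding disjoint_family_on_def
  proof (intro ballI impI)
    fix i j :: nat assume "i \<noteq> j"
    then show "J i \<inter> J j = {}"
      using mono[of "Suc i" j] mono[of "Suc j" i] by (cases "i < j") (auto simp: J_def)
  qed
  have less: "ennreal ((V (Suc n) - V n) * g (v n)) < (\<integral>\<^sup>+x\<in>J n. ennreal (g x) \<partial>lborel)" for n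
  proof -
    have pos: "0 < (V n + V (Suc n)) / 2"
      using Vn[of n] V(2)[of n] by simp
    have "g (v n) \<le> g ((V n + V (Suc n)) / 2)"
      by (rule decr[OF pos v])
    then have "ennreal ((V (Suc n) - V n) * g (v n)) \<le> ennreal ((V (Suc n) - V n) * g ((V n + V (Suc n)) / 2))"
      using V(2)[of n] by (intro ennreal_leI mult_left_mono) auto
    also have "\<dots> < (\<integral>\<^sup>+x\<in>J n. ennreal (g x) \<partial>lborel)"
      unfolding J_def using V(2) Vn nonneg mid by (intro midpoint_less_integral) auto
    finally show ?thesis .
  qed
  have sum_le: "(\<Sum>n. \<integral>\<^sup>+x\<in>J n. ennreal (g x) \<partial>lborel) \<le> (\<integral>\<^sup>+x\<in>{0<..}. ennreal (g x) \<partial>lborel)"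
  proof -
    have "(\<Sum>n. \<integral>\<^sup>+x\<in>J n. ennreal (g x) \<partial>lborel) = (\<integral>\<^sup>+x. (\<Sum>n. ennreal (g x) * indicator (J n) x) \<partial>lborel)"
      by (rule nn_integral_suminf[symmetric]) (auto simp: J_def)
    also have "\<dots> = (\<integral>\<^sup>+x\<in>(\<Union>n. J n). ennreal (g x) \<partial>lborel)"
      by (simp only: ennreal_suminf_cmult suminf_indicator[OF disj])
    also have "\<dots> \<le> (\<integral>\<^sup>+x\<in>{0<..}. ennreal (g x) \<partial>lborel)"
      by (intro nn_integral_mono) (auto split: split_indicator simp: J_def intro: le_less_trans[OF Vn])
    finally show ?thesis .
  qed
  have "(\<Sum>n. ennreal ((V (Suc n) - V n) * g (v n))) < (\<Sum>n. \<integral>\<^sup>+x\<in>J n. ennreal (g x) \<partial>lborel)"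
    unfolding nn_integral_count_space_nat[symmetric]
  proof (rule nn_integral_less)
    have "(\<Sum>n. ennreal ((V (Suc n) - V n) * g (v n))) \<le> (\<Sum>n. \<integral>\<^sup>+x\<in>J n. ennreal (g x) \<partial>lborel)"
      using less[THEN less_imp_le] by (intro suminf_le) auto
    also note sum_le
    also note fin
    finally show "(\<integral>\<^sup>+n. ennreal ((V (Suc n) - V n) * g (v n)) \<partial>count_space UNIV) \<noteq> \<infinity>"
      by (simp add: nn_integral_count_space_nat)
    show "AE n in count_space UNIV. ennreal ((V (Suc n) - V n) * g (v n)) \<le> (\<integral>\<^sup>+x\<in>J n. ennreal (g x) \<partial>lborel)"
      unfolding AE_count_space using less[THEN less_imp_le] by blast
    show "\<not> (AE n in count_space UNIV. (\<integral>\<^sup>+x\<in>J n. ennreal (g x) \<partial>lborel) \<le> ennreal ((V (Suc n) - V n) * g (v n)))"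
      unfolding AE_count_space not_all using less[of 0] by (auto simp: not_le)
  qed simp_all
  with sum_le show ?thesis by simp
qed

section \<open>Integrability of the kernel\<close>

lemma csch_le_inverse:
  assumes "0 < u"
  shows "csch u \<le> 2 / u"
proof -
  have "u \<le> exp u - exp (- u)"
    using exp_ge_add_one_self[of u] assms by (smt (verit) exp_le_one_iff)
  then show ?thesis
    using assms unfolding csch_def by (intro divide_left_mono) auto
qed

text \<open>Polynomial decay of any order \<open>k\<close>, from \<open>(1 + u / k)\<^sup>k \<le> exp u\<close>.\<close>

lemma csch_le_inverse_power:
  assumes "0 < d" "d \<le> u" "0 < k"
  shows "csch u \<le> 2 * real k ^ k / (u ^ k * (1 - exp (- 2 * d)))"
proof -
  have "(u / real k) ^ k \<le> (1 + u / real k) ^ k"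
    using assms by (intro power_mono) auto
  also have "\<dots> \<le> exp u"
    using assms by (intro exp_ge_one_plus_x_over_n_power_n) auto
  finally have "(u / real k) ^ k * (1 - exp (- 2 * d)) \<le> exp u * (1 - exp (- 2 * u))"
    using assms by (intro mult_mono) auto
  also have "\<dots> = exp u - exp (- u)"
    by (simp add: right_diff_distrib flip: exp_add)
  finally have "csch u \<le> 2 / ((u / real k) ^ k * (1 - exp (- 2 * d)))"
    using assms unfolding csch_def by (intro divide_left_mono mult_pos_pos) auto
  also have "\<dots> = 2 * real k ^ k / (u ^ k * (1 - exp (- 2 * d)))"
    using assms by (simp add: power_divide)
  finally show ?thesis .
qed

lemma kern_le_csch: "0 \<le> \<alpha> \<Longrightarrow> 0 < \<rho> \<Longrightarrow> kern \<alpha> \<rho> \<gamma> t \<le> csch (\<rho> * t powr \<gamma>)"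
  using divide_left_mono[of 1 "exp (\<alpha> * t powr \<gamma>)" "csch (\<rho> * t powr \<gamma>)"] unfolding kern_def by (simp add: csch_def)

text \<open>Near \<open>0\<close> the integrand is \<open>O(t\<^bsup>\<sigma>-1-\<gamma>\<^esup>)\<close>, which is integrable because \<open>\<gamma> < \<sigma>\<close>; near infinity it is
\<open>O(t\<^bsup>\<sigma>-1-k\<gamma>\<^esup>)\<close> for every \<open>k\<close>, and \<open>k > \<sigma>/\<gamma>\<close> suffices.\<close>

lemma integral_kern_finite:
  assumes "0 \<le> \<alpha>" "0 < \<rho>" "0 < \<gamma>" "\<gamma> < \<sigma>"
  shows "(\<integral>\<^sup>+t\<in>{0<..}. ennreal (kern \<alpha> \<rho> \<gamma> t * t powr (\<sigma> - 1)) \<partial>lborel) < top"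
proof -
  obtain k :: nat where k: "\<sigma> / \<gamma> < real k"
    using reals_Archimedean2 by blast
  have k': "\<sigma> - 1 - real k * \<gamma> < -1"
    using k assms by (simp add: field_simps)
  have "0 < \<sigma> / \<gamma>"
    using assms by simp
  with k have k0: "0 < k"
    by (cases k) auto
  \<comment> \<open>The constant of \<open>csch_le_inverse_power\<close> with \<open>d = \<rho>\<close>, as \<open>\<rho> t\<^sup>\<gamma> \<ge> \<rho>\<close> for \<open>t \<ge> 1\<close>.\<close>
  define c where "c = 2 * real k ^ k / (\<rho> ^ k * (1 - exp (- 2 * \<rho>)))"
  have c: "0 \<le> c"
    using assms by (simp add: c_def)
  have small: "kern \<alpha> \<rho> \<gamma> t * t powr (\<sigma> - 1) \<le> 2 / \<rho> * t powr (\<sigma> - 1 - \<gamma>)" if "0 < t" for t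
  proof -
    have "kern \<alpha> \<rho> \<gamma> t * t powr (\<sigma> - 1) \<le> 2 / (\<rho> * t powr \<gamma>) * t powr (\<sigma> - 1)"
      using kern_le_csch[of \<alpha> \<rho> \<gamma> t] csch_le_inverse[of "\<rho> * t powr \<gamma>"] assms that
      by (intro mult_right_mono) auto
    then show ?thesis
      by (simp add: powr_diff mult_ac)
  qed
  have large: "kern \<alpha> \<rho> \<gamma> t * t powr (\<sigma> - 1) \<le> c * t powr (\<sigma> - 1 - real k * \<gamma>)" if "1 \<le> t" for t
  proof -
    have "\<rho> \<le> \<rho> * t powr \<gamma>"
      using assms that ge_one_powr_ge_zero[of t \<gamma>] by simp
    then have "kern \<alpha> \<rho> \<gamma> t \<le> 2 * real k ^ k / ((\<rho> * t powr \<gamma>) ^ k * (1 - exp (- 2 * \<rho>)))"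
      using kern_le_csch[of \<alpha> \<rho> \<gamma> t] csch_le_inverse_power[of \<rho> "\<rho> * t powr \<gamma>" k] assms k0 by linarith
    also have "\<dots> = c / t powr (real k * \<gamma>)"
      using that by (simp add: c_def power_mult_distrib powr_power mult.commute)
    finally have "kern \<alpha> \<rho> \<gamma> t * t powr (\<sigma> - 1) \<le> c / t powr (real k * \<gamma>) * t powr (\<sigma> - 1)"
      by (intro mult_right_mono) auto
    then show ?thesis
      by (simp add: powr_diff mult_ac)
  qed
  have "(\<integral>\<^sup>+t\<in>{0<..}. ennreal (kern \<alpha> \<rho> \<gamma> t * t powr (\<sigma> - 1)) \<partial>lborel)
     \<le> (\<integral>\<^sup>+t. ennreal (2 / \<rho> * t powr (\<sigma> - 1 - \<gamma>)) * indicator {0..1} t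
           + ennreal (c * t powr (\<sigma> - 1 - real k * \<gamma>)) * indicator {1..} t \<partial>lborel)"
  proof (intro nn_integral_mono)
    fix t :: real
    show "ennreal (kern \<alpha> \<rho> \<gamma> t * t powr (\<sigma> - 1)) * indicator {0<..} t
      \<le> ennreal (2 / \<rho> * t powr (\<sigma> - 1 - \<gamma>)) * indicator {0..1} t
           + ennreal (c * t powr (\<sigma> - 1 - real k * \<gamma>)) * indicator {1..} t"
    proof (cases "0 < t")
      case True
      show ?thesis
      proof (cases "t \<le> 1")
        case True
        with \<open>0 < t\<close> show ?thesis
          using ennreal_leI[OF small[of t]] by (simp add: add_increasing2)
      next
        case False
        then show ?thesis
          using ennreal_leI[OF large[of t]] by simp
      qed
    qed simp
  qed
  also have "\<dots> = (\<integral>\<^sup>+t\<in>{0..1}. ennreal (2 / \<rho> * t powr (\<sigma> - 1 - \<gamma>)) \<partial>lborel)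
           + (\<integral>\<^sup>+t\<in>{1..}. ennreal (c * t powr (\<sigma> - 1 - real k * \<gamma>)) \<partial>lborel)"
    by (intro nn_integral_add) auto
  also have "\<dots> < top"
  proof -
    have "((\<lambda>t. 2 / \<rho> * t powr (\<sigma> - 1 - \<gamma>)) has_integral
        2 / \<rho> * (1 powr (\<sigma> - 1 - \<gamma> + 1) / (\<sigma> - 1 - \<gamma> + 1))) {0..1}"
      using assms by (intro has_integral_mult_right has_integral_powr_from_0) auto
    moreover have "((\<lambda>t. c * t powr (\<sigma> - 1 - real k * \<gamma>)) has_integral
        c * (-(1 powr (\<sigma> - 1 - real k * \<gamma> + 1)) / (\<sigma> - 1 - real k * \<gamma> + 1))) {1..}"
      using k' by (intro has_integral_mult_right has_integral_powr_to_inf) auto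
    ultimately show ?thesis
      using assms c by (simp add: nn_integral_has_integral_lebesgue' del: ennreal_mult')
  qed
  finally show ?thesis .
qed

section \<open>Substituting a power of U\<close>

abbreviation halfline :: "real measure" where
  "halfline \<equiv> lebesgue_on {0<..}"

lemma nn_integral_halfline:
  "(\<integral>\<^sup>+x. f x \<partial>halfline) = (\<integral>\<^sup>+x\<in>{0<..}. f x \<partial>lebesgue)"
  by (simp add: nn_integral_restrict_space)

lemma nn_integral_lebesgue_on_eq_integral:
  fixes f :: "real \<Rightarrow> real"
  assumes "S \<in> sets lebesgue" "f integrable_on S" "\<And>x. x \<in> S \<Longrightarrow> 0 \<le> f x"
  shows "(\<integral>\<^sup>+x. ennreal (f x) \<partial>lebesgue_on S) = ennreal (integral S f)"
  using nn_integral_has_integral_lebesgue'[of S f "integral S f"] assms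
  by (simp add: nn_integral_restrict_space nn_integral_completion integrable_integral)

text \<open>A nonnegative integrable function is absolutely integrable, and for such functions the change of variables
formula also yields integrability on the domain, so that both nonnegative integrals are finite gauge integrals.\<close>

lemma nn_integral_change_of_variables:
  fixes \<phi> \<phi>' F :: "real \<Rightarrow> real"
  assumes S: "S \<in> sets lebesgue" and T: "\<phi> ` S = T" "T \<in> sets lebesgue"
    and deriv: "\<And>x. x \<in> S \<Longrightarrow> (\<phi> has_field_derivative \<phi>' x) (at x within S)"
    and inj: "inj_on \<phi> S"
    and F: "F integrable_on T" "\<And>t. t \<in> T \<Longrightarrow> 0 \<le> F t"
  shows "(\<integral>\<^sup>+x. ennreal (\<bar>\<phi>' x\<bar> * F (\<phi> x)) \<partial>lebesgue_on S) = (\<integral>\<^sup>+t. ennreal (F t) \<partial>lebesgue_on T)"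
proof -
  have "F absolutely_integrable_on T"
    using F by (intro nonnegative_absolutely_integrable_1) auto
  then have *: "(\<lambda>x. \<bar>\<phi>' x\<bar> * F (\<phi> x)) absolutely_integrable_on S \<and>
      integral S (\<lambda>x. \<bar>\<phi>' x\<bar> * F (\<phi> x)) = integral T F"
    using has_absolute_integral_change_of_variables_1'[OF S deriv inj, of F "integral T F"] T(1) by simp
  then have "(\<lambda>x. \<bar>\<phi>' x\<bar> * F (\<phi> x)) integrable_on S"
    using absolutely_integrable_on_def by blast
  moreover have "0 \<le> \<bar>\<phi>' x\<bar> * F (\<phi> x)" if "x \<in> S" for x
    using F(2) T(1) that by auto
  ultimately show ?thesis
    using * F S T(2) by (simp add: nn_integral_lebesgue_on_eq_integral)
qed

locale divergent_weight =
  fixes \<mu> :: "real \<Rightarrow> real"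
  assumes \<mu>_cont: "continuous_on {0<..} \<mu>"
    and \<mu>_pos: "\<And>t. t > 0 \<Longrightarrow> \<mu> t > 0"
    and \<mu>_int: "\<And>x. x > 0 \<Longrightarrow> set_integrable lebesgue {0<..<x} \<mu>"
    and U_inf: "U_inf \<mu> = \<infinity>"
begin

lemma \<mu>_nonneg: "0 < t \<Longrightarrow> 0 \<le> \<mu> t"
  using \<mu>_pos by (simp add: less_imp_le)

lemma \<mu>_integrable_Icc: "0 < x \<Longrightarrow> \<mu> integrable_on {0..x}"
  using set_lebesgue_integral_eq_integral(1)[OF \<mu>_int]
  by (simp add: integrable_on_open_interval_real)

lemma U_eq_integral: "0 < x \<Longrightarrow> U \<mu> x = integral {0..x} \<mu>"
  using set_lebesgue_integral_eq_integral(2)[OF \<mu>_int]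
  by (simp add: U_def integral_open_interval_real)

lemma nn_integral_\<mu>: "0 < x \<Longrightarrow> (\<integral>\<^sup>+t\<in>{0<..<x}. ennreal (\<mu> t) \<partial>lebesgue) = ennreal (U \<mu> x)"
proof -
  assume x: "0 < x"
  have "(\<integral>\<^sup>+t\<in>{0<..<x}. ennreal (\<mu> t) \<partial>lebesgue) = (\<integral>\<^sup>+t. ennreal (indicator {0<..<x} t *\<^sub>R \<mu> t) \<partial>lebesgue)"
    by (intro nn_integral_cong) (auto split: split_indicator)
  also have "\<dots> = ennreal (U \<mu> x)"
    unfolding U_def set_lebesgue_integral_def
    using \<mu>_int[OF x] \<mu>_nonneg unfolding set_integrable_def
    by (intro nn_integral_eq_integral) (auto split: split_indicator)
  finally show ?thesis .
qed

text \<open>Since \<open>\<mu>\<close> is continuous only away from \<open>0\<close>, the fundamental theorem of calculus is used pointwise, on an integral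
that starts at the possibly singular endpoint.\<close>

lemma U_has_derivative: "0 < x \<Longrightarrow> (U \<mu> has_real_derivative \<mu> x) (at x)"
proof -
  assume x: "0 < x"
  have "((\<lambda>u. integral {0..u} \<mu>) has_vector_derivative \<mu> x) (at x within ({0..x + 1} - {}))"
  proof (rule integral_has_vector_derivative_continuous_at)
    show "\<mu> integrable_on {0..x + 1}"
      using x by (intro \<mu>_integrable_Icc) auto
    have "isCont \<mu> x"
      using \<mu>_cont x by (auto simp: continuous_on_eq_continuous_at)
    then show "continuous (at x within ({0..x + 1} - {})) \<mu>"
      by (rule continuous_at_imp_continuous_at_within)
  qed (use x in auto)
  then have "((\<lambda>u. integral {0..u} \<mu>) has_vector_derivative \<mu> x) (at x within {0<..<x + 1})"
    by (rule has_vector_derivative_within_subset) auto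
  then have "((\<lambda>u. integral {0..u} \<mu>) has_vector_derivative \<mu> x) (at x)"
    by (subst (asm) at_within_open) (use x in auto)
  then have "(U \<mu> has_vector_derivative \<mu> x) (at x)"
    by (rule has_vector_derivative_transform_within_open[of _ _ _ "{0<..}"])
      (use x in \<open>auto simp: U_eq_integral\<close>)
  then show ?thesis
    by (simp add: has_real_derivative_iff_has_vector_derivative)
qed

lemma continuous_on_U: "continuous_on {0<..} (U \<mu>)"
  by (intro continuous_at_imp_continuous_on ballI DERIV_isCont[OF U_has_derivative]) simp

lemma U_strict_mono:
  assumes "0 < x" "x < y"
  shows "U \<mu> x < U \<mu> y"
proof (rule DERIV_pos_imp_increasing[OF assms(2)])
  fix t assume "x \<le> t" "t \<le> y"
  with assms show "\<exists>d. (U \<mu> has_real_derivative d) (at t) \<and> 0 < d"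
    using U_has_derivative[of t] \<mu>_pos[of t] by (intro exI[of _ "\<mu> t"]) simp
qed

lemma U_nonneg: "0 < x \<Longrightarrow> 0 \<le> U \<mu> x"
  using \<mu>_nonneg unfolding U_def set_lebesgue_integral_def
  by (intro integral_nonneg_AE AE_I2) (auto split: split_indicator)

lemma U_pos: "0 < x \<Longrightarrow> 0 < U \<mu> x"
  using U_nonneg[of "x / 2"] U_strict_mono[of "x / 2" x] by simp

lemma U_small: "0 < e \<Longrightarrow> \<exists>x>0. U \<mu> x < e"
proof -
  assume e: "0 < e"
  have "continuous_on {0..1} (\<lambda>x. integral {0..x} \<mu>)"
    using \<mu>_integrable_Icc[of 1] by (intro indefinite_integral_continuous_1) auto
  then obtain d where d: "d > 0" "\<And>x. x \<in> {0..1} \<Longrightarrow> dist x 0 < d \<Longrightarrow> dist (integral {0..x} \<mu>) (integral {0..0} \<mu>) < e"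
    using e unfolding continuous_on_iff by (metis atLeastAtMost_iff order_refl zero_le_one)
  define x where "x = min 1 (d / 2)"
  have "0 < x" "x \<le> 1" "x < d" using d by (auto simp: x_def)
  then show ?thesis
    using d(2)[of x] by (intro exI[of _ x]) (simp add: U_eq_integral dist_real_def)
qed

text \<open>By monotone convergence \<open>U(\<infinity>)\<close> is the supremum of the values of \<open>U\<close>.\<close>

lemma U_large: "\<exists>x>0. B < U \<mu> x"
proof (rule ccontr)
  assume "\<not> ?thesis"
  then have le: "U \<mu> x \<le> B" if "0 < x" for x
    using that by force
  have "U_inf \<mu> = (\<integral>\<^sup>+t. (SUP n::nat. ennreal (\<mu> t) * indicator {0<..<real (Suc n)} t) \<partial>lebesgue)"
    unfolding U_inf_def
  proof (intro nn_integral_cong)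
    fix t :: real
    obtain n :: nat where "t < real n"
      using reals_Archimedean2 by blast
    then have n: "t < real (Suc n)" by simp
    show "ennreal (\<mu> t) * indicator {0<..} t = (SUP n::nat. ennreal (\<mu> t) * indicator {0<..<real (Suc n)} t)"
    proof (rule antisym)
      show "ennreal (\<mu> t) * indicator {0<..} t \<le> (SUP n::nat. ennreal (\<mu> t) * indicator {0<..<real (Suc n)} t)"
        using n by (intro SUP_upper2[of n]) (auto split: split_indicator)
    qed (auto intro!: SUP_least split: split_indicator)
  qed
  also have "\<dots> = (SUP n::nat. \<integral>\<^sup>+t\<in>{0<..<real (Suc n)}. ennreal (\<mu> t) \<partial>lebesgue)"
  proof (rule nn_integral_monotone_convergence_SUP)
    show "incseq (\<lambda>n t. ennreal (\<mu> t) * indicator {0<..<real (Suc n)} t)"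
      by (intro incseq_SucI le_funI) (auto split: split_indicator)
    fix n :: nat
    have "(\<lambda>t. indicator {0<..<real (Suc n)} t *\<^sub>R \<mu> t) \<in> borel_measurable lebesgue"
      using \<mu>_int[of "real (Suc n)"] unfolding set_integrable_def by auto
    then have "(\<lambda>t. ennreal (indicator {0<..<real (Suc n)} t *\<^sub>R \<mu> t)) \<in> borel_measurable lebesgue"
      by measurable
    also have "(\<lambda>t. ennreal (indicator {0<..<real (Suc n)} t *\<^sub>R \<mu> t)) = (\<lambda>t. ennreal (\<mu> t) * indicator {0<..<real (Suc n)} t)"
      by (auto split: split_indicator)
    finally show "(\<lambda>t. ennreal (\<mu> t) * indicator {0<..<real (Suc n)} t) \<in> borel_measurable lebesgue" .
  qed
  also have "\<dots> \<le> ennreal B"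
    using le by (intro SUP_least) (simp add: nn_integral_\<mu> ennreal_leI del: of_nat_Suc)
  finally show False
    using U_inf by (simp add: top_unique)
qed

lemma U_image: "U \<mu> ` {0<..} = {0<..}"
proof (intro equalityI subsetI)
  fix y :: real assume "y \<in> {0<..}"
  then obtain a b where ab: "0 < a" "U \<mu> a < y" "0 < b" "y < U \<mu> b"
    using U_small[of y] U_large[of y] by auto
  then have "a < b"
    using U_strict_mono[of b a] by (cases "a = b") (auto simp: not_less_iff_gr_or_eq intro: ccontr)
  moreover have "continuous_on {a..b} (U \<mu>)"
    by (rule continuous_on_subset[OF continuous_on_U]) (use ab in auto)
  ultimately have "\<exists>x\<ge>a. x \<le> b \<and> U \<mu> x = y"
    using ab by (intro IVT') auto
  with ab show "y \<in> U \<mu> ` {0<..}"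
    by force
qed (auto intro: U_pos)

lemma U_measurable [measurable]: "U \<mu> \<in> borel_measurable halfline"
  by (intro continuous_imp_measurable_on_sets_lebesgue continuous_on_U) auto

lemma \<mu>_measurable [measurable]: "\<mu> \<in> borel_measurable halfline"
  by (intro continuous_imp_measurable_on_sets_lebesgue \<mu>_cont) auto

text \<open>The map \<open>\<phi>(x) = U(x)\<^sup>\<delta> v\<close> is a bijection of the half-line whose logarithmic derivative is
\<open>\<delta> \<mu> / U\<close>.  So for \<open>|\<delta>| = 1\<close>, and independently of \<open>v\<close>, it carries \<open>(\<mu>/U) dx\<close> to the
scale-invariant measure \<open>dt/t\<close>.\<close>

lemma nn_integral_powr_U:
  fixes F :: "real \<Rightarrow> real"
  assumes \<delta>: "\<bar>\<delta>\<bar> = 1" and v: "0 < v"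
    and F: "\<And>t. 0 < t \<Longrightarrow> 0 \<le> F t" "(\<lambda>t. F t / t) integrable_on {0<..}"
  shows "(\<integral>\<^sup>+x. ennreal (\<mu> x / U \<mu> x * F (U \<mu> x powr \<delta> * v)) \<partial>halfline)
    = (\<integral>\<^sup>+t. ennreal (F t / t) \<partial>halfline)"
proof -
  have \<delta>0: "\<delta> \<noteq> 0"
    using \<delta> by auto
  define \<phi> where "\<phi> x = U \<mu> x powr \<delta> * v" for x
  define \<phi>' where "\<phi>' x = \<delta> * U \<mu> x powr (\<delta> - 1) * \<mu> x * v" for x
  have \<phi>_pos: "0 < \<phi> x" if "0 < x" for x
    using U_pos[OF that] v by (simp add: \<phi>_def)
  have inj: "inj_on \<phi> {0<..}"
  proof (rule inj_onI)
    fix x y :: real assume xy: "x \<in> {0<..}" "y \<in> {0<..}" "\<phi> x = \<phi> y"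
    then have "(U \<mu> x powr \<delta>) powr (1 / \<delta>) = (U \<mu> y powr \<delta>) powr (1 / \<delta>)"
      using v by (simp add: \<phi>_def)
    then have "U \<mu> x = U \<mu> y"
      using \<delta>0 xy U_nonneg by (auto simp: powr_powr)
    then show "x = y"
      using xy U_strict_mono[of x y] U_strict_mono[of y x] by (cases x y rule: linorder_cases) auto
  qed
  have image: "\<phi> ` {0<..} = {0<..}"
  proof (intro equalityI subsetI)
    fix t :: real assume t: "t \<in> {0<..}"
    then have "(t / v) powr (1 / \<delta>) \<in> U \<mu> ` {0<..}"
      using v by (simp add: U_image)
    then obtain x where x: "0 < x" "U \<mu> x = (t / v) powr (1 / \<delta>)"
      by auto
    then have "\<phi> x = t"
      using t v \<delta>0 by (auto simp: \<phi>_def powr_powr)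
    with x show "t \<in> \<phi> ` {0<..}"
      by auto
  qed (use \<phi>_pos in auto)
  have "(\<integral>\<^sup>+x. ennreal (\<bar>\<phi>' x\<bar> * (F (\<phi> x) / \<phi> x)) \<partial>halfline) = (\<integral>\<^sup>+t. ennreal (F t / t) \<partial>halfline)"
  proof (rule nn_integral_change_of_variables)
    fix x :: real assume "x \<in> {0<..}"
    then have "(\<phi> has_real_derivative \<phi>' x) (at x)"
      unfolding \<phi>_def \<phi>'_def using U_pos[of x] U_has_derivative[of x]
      by (auto intro!: derivative_eq_intros simp: powr_diff)
    then show "(\<phi> has_real_derivative \<phi>' x) (at x within {0<..})"
      by (rule has_field_derivative_at_within)
  qed (use image inj F in auto)
  moreover have "\<bar>\<phi>' x\<bar> * (F (\<phi> x) / \<phi> x) = \<mu> x / U \<mu> x * F (\<phi> x)" if "0 < x" for x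
    using U_pos[OF that] \<mu>_pos[OF that] v \<delta> by (simp add: \<phi>_def \<phi>'_def abs_mult powr_diff)
  ultimately show ?thesis
    unfolding \<phi>_def[symmetric] by (simp cong: nn_integral_cong_simp)
qed

end

section \<open>The scale-invariant form of the problem\<close>

lemma partial_sum_Suc: "partial_sum \<nu> (Suc n) = partial_sum \<nu> n + \<nu> (Suc n)"
  by (simp add: partial_sum_def)

locale half_discrete = divergent_weight \<mu> for \<mu> :: "real \<Rightarrow> real" +
  fixes \<alpha> \<rho> \<gamma> \<sigma> \<delta> p q :: real and \<nu> \<nu>t :: "nat \<Rightarrow> real"
  assumes \<nu>_pos: "\<And>n. n \<ge> 1 \<Longrightarrow> \<nu> n > 0"
    and \<nu>t: "\<And>n. n \<ge> 1 \<Longrightarrow> \<nu>t n \<in> {0..\<nu> n / 2}"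
    and \<alpha>: "0 \<le> \<alpha>" and \<rho>: "0 < \<rho>" and \<gamma>: "0 < \<gamma>" and \<gamma>\<sigma>: "\<gamma> < \<sigma>" and \<sigma>: "\<sigma> \<le> 1"
    and \<delta>: "\<bar>\<delta>\<bar> = 1" and p: "1 < p" and pq: "1 / p + 1 / q = 1"
begin

lemma q: "1 < q"
proof -
  have "0 < 1 / p" "1 / p < 1"
    using p by simp_all
  then have "0 < 1 / q" "1 / q < 1"
    using pq by linarith+
  then show ?thesis
    by simp
qed

abbreviation v :: "nat \<Rightarrow> real" where "v n \<equiv> Vt \<nu> \<nu>t (Suc n)"

text \<open>Sequences are shifted by one from here on: index \<open>n\<close> stands for the \<open>(n+1)\<close>-st term.  The weights \<open>w\<close> are the
discrete counterpart of the measure \<open>m\<close>, whose density is the logarithmic derivative of \<open>U\<close>.\<close>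

definition w :: "nat \<Rightarrow> real" where "w n = \<nu> (Suc n) / v n"

definition g :: "real \<Rightarrow> real" where "g t = kern \<alpha> \<rho> \<gamma> t * t powr (\<sigma> - 1)"

abbreviation k :: real where "k \<equiv> k_const \<alpha> \<rho> \<gamma> \<sigma>"

definition G :: "nat \<Rightarrow> real \<Rightarrow> real" where
  "G n x = (U \<mu> x powr \<delta> * v n) powr \<sigma> * kern \<alpha> \<rho> \<gamma> (U \<mu> x powr \<delta> * v n)"

definition m :: "real measure" where
  "m = density halfline (\<lambda>x. ennreal (\<mu> x / U \<mu> x))"

lemma space_m [simp]: "space m = {0<..}"
  by (simp add: m_def space_restrict_space)

lemma measurable_m_iff: "f \<in> borel_measurable m \<longleftrightarrow> f \<in> borel_measurable halfline"
  by (simp add: m_def)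

lemma nn_integral_m:
  assumes "f \<in> borel_measurable halfline"
  shows "(\<integral>\<^sup>+x. f x \<partial>m) = (\<integral>\<^sup>+x. ennreal (\<mu> x / U \<mu> x) * f x \<partial>halfline)"
  unfolding m_def using assms by (subst nn_integral_density) auto

lemma partial_sum_strict_mono: "partial_sum \<nu> n < partial_sum \<nu> (Suc n)"
  using \<nu>_pos[of "Suc n"] by (simp add: partial_sum_Suc)

lemma partial_sum_nonneg: "0 \<le> partial_sum \<nu> n"
  unfolding partial_sum_def using \<nu>_pos by (intro sum_nonneg less_imp_le) simp

text \<open>This is the role of the bound \<open>\<nu>~\<^sub>n \<le> \<nu>\<^sub>n/2\<close>.\<close>

lemma v_ge_midpoint: "(partial_sum \<nu> n + partial_sum \<nu> (Suc n)) / 2 \<le> v n"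
  using \<nu>t[of "Suc n"] by (simp add: Vt_def partial_sum_Suc)

lemma v_le: "v n \<le> partial_sum \<nu> (Suc n)"
  using \<nu>t[of "Suc n"] by (simp add: Vt_def)

lemma v_pos: "0 < v n"
  using v_ge_midpoint[of n] partial_sum_nonneg[of n] partial_sum_strict_mono[of n] by simp

lemma w_pos: "0 < w n"
  using v_pos[of n] \<nu>_pos[of "Suc n"] by (simp add: w_def)

lemma g_nonneg: "0 \<le> g t"
  using kern_nonneg[of \<rho>] \<rho> by (simp add: g_def)

lemma g_measurable [measurable]: "g \<in> borel_measurable borel"
  unfolding g_def[abs_def] by measurable

lemma integral_g_finite: "(\<integral>\<^sup>+t\<in>{0<..}. ennreal (g t) \<partial>lborel) < top"
  unfolding g_def using integral_kern_finite \<alpha> \<rho> \<gamma> \<gamma>\<sigma> by blast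

lemma set_integrable_g: "set_integrable lebesgue {0<..} g"
  unfolding set_integrable_def
proof (rule integrableI_bounded)
  show "(\<lambda>t. indicat_real {0<..} t *\<^sub>R g t) \<in> borel_measurable lebesgue"
    by (rule measurable_completion) auto
  have "(\<integral>\<^sup>+t. ennreal (norm (indicat_real {0<..} t *\<^sub>R g t)) \<partial>lebesgue) = (\<integral>\<^sup>+t\<in>{0<..}. ennreal (g t) \<partial>lborel)"
    unfolding nn_integral_completion
    using g_nonneg by (intro nn_integral_cong) (auto split: split_indicator)
  with integral_g_finite show "(\<integral>\<^sup>+t. ennreal (norm (indicat_real {0<..} t *\<^sub>R g t)) \<partial>lebesgue) < \<infinity>"
    by simp
qed

lemma k_eq_integral: "k = integral {0<..} g"
  using set_lebesgue_integral_eq_integral(2)[OF set_integrable_g]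
  by (simp add: k_const_def g_def[abs_def] kern_def[abs_def])

lemma g_integrable: "g integrable_on {0<..}"
  using set_lebesgue_integral_eq_integral(1)[OF set_integrable_g] .

lemma nn_integral_g: "(\<integral>\<^sup>+t. ennreal (g t) \<partial>halfline) = ennreal k"
  using nn_integral_lebesgue_on_eq_integral[OF _ g_integrable] g_nonneg by (simp add: k_eq_integral)

lemma nn_integral_g_lborel: "(\<integral>\<^sup>+t\<in>{0<..}. ennreal (g t) \<partial>lborel) = ennreal k"
  using nn_integral_g by (simp add: nn_integral_halfline nn_integral_completion)

text \<open>The scale \<open>c\<close> is absorbed into the partition: the points \<open>c V\<^sub>n\<close> partition the half-line just as well as
the \<open>V\<^sub>n\<close>.\<close>

lemma sum_g_less:
  assumes "0 < c"
  shows "(\<Sum>n. ennreal (c * \<nu> (Suc n) * g (c * v n))) < ennreal k"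
proof -
  have "(\<Sum>n. ennreal ((c * partial_sum \<nu> (Suc n) - c * partial_sum \<nu> n) * g (c * v n)))
      < (\<integral>\<^sup>+t\<in>{0<..}. ennreal (g t) \<partial>lborel)"
  proof (rule sum_midpoints_less_integral)
    show "2 * g ((x + y) / 2) < g x + g y" if "0 < x" "x < y" for x y
      unfolding g_def using \<alpha> \<rho> \<gamma> \<gamma>\<sigma> \<sigma> that by (intro kern_powr_midpoint_less) auto
    show "g y \<le> g x" if "0 < x" "x \<le> y" for x y
      using kern_powr_decreasing[of \<alpha> \<rho> \<gamma> \<sigma> x y] \<alpha> \<rho> \<gamma> \<gamma>\<sigma> \<sigma> that
      by (cases "x = y") (auto simp: g_def)
    show "(c * partial_sum \<nu> n + c * partial_sum \<nu> (Suc n)) / 2 \<le> c * v n" for n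
      using mult_left_mono[OF v_ge_midpoint[of n], of c] assms by (simp add: algebra_simps)
  qed (use assms g_nonneg integral_g_finite partial_sum_strict_mono partial_sum_nonneg in auto)
  then show ?thesis
    unfolding nn_integral_g_lborel by (simp add: partial_sum_Suc algebra_simps)
qed

lemma k_pos: "0 < k"
  using le_less_trans[OF zero_le sum_g_less[of 1]] by simp

lemma w_G: "0 < x \<Longrightarrow> w n * G n x = U \<mu> x powr \<delta> * \<nu> (Suc n) * g (U \<mu> x powr \<delta> * v n)"
  using v_pos[of n] U_pos[of x] by (simp add: w_def G_def g_def powr_diff)

lemma G_nonneg: "0 \<le> G n x"
  using kern_nonneg[of \<rho>] \<rho> by (simp add: G_def)

lemma G_measurable [measurable]: "G n \<in> borel_measurable halfline"
  unfolding G_def[abs_def] by measurable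

sublocale schur_kernel m "\<lambda>n. ennreal (w n)" "\<lambda>n x. ennreal (G n x)" "ennreal k"
proof
  show "(\<lambda>x. ennreal (G n x)) \<in> borel_measurable m" for n
    unfolding measurable_m_iff by measurable
  show "(\<integral>\<^sup>+x. ennreal (G n x) \<partial>m) = ennreal k" for n
  proof -
    define F where "F t = t powr \<sigma> * kern \<alpha> \<rho> \<gamma> t" for t
    have F: "F t / t = g t" if "0 < t" for t
      using that by (simp add: F_def g_def powr_diff)
    have F_int: "(\<lambda>t. F t / t) integrable_on {0<..}"
      by (rule integrable_eq[OF g_integrable]) (simp add: F)
    have "(\<integral>\<^sup>+x. ennreal (G n x) \<partial>m) = (\<integral>\<^sup>+x. ennreal (\<mu> x / U \<mu> x * F (U \<mu> x powr \<delta> * v n)) \<partial>halfline)"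
      using U_pos \<mu>_pos
      by (subst nn_integral_m) (auto simp: F_def G_def ennreal_mult'[symmetric] less_imp_le space_restrict_space
          intro!: nn_integral_cong)
    also have "\<dots> = (\<integral>\<^sup>+t. ennreal (F t / t) \<partial>halfline)"
      using \<rho> kern_nonneg[of \<rho>] by (intro nn_integral_powr_U \<delta> v_pos F_int) (auto simp: F_def)
    also have "\<dots> = (\<integral>\<^sup>+t. ennreal (g t) \<partial>halfline)"
      by (intro nn_integral_cong) (simp add: F space_restrict_space)
    finally show ?thesis
      by (simp add: nn_integral_g)
  qed
  show "(\<Sum>n. ennreal (w n) * ennreal (G n x)) < ennreal k" if "x \<in> space m" for x
    using sum_g_less[of "U \<mu> x powr \<delta>"] that U_pos[of x] w_pos less_imp_le[OF w_pos] G_nonneg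
    by (simp add: ennreal_mult[symmetric] w_G)
qed (use k_pos in auto)

end

section \<open>The three inequalities\<close>

text \<open>The weights of both norms have this shape, with \<open>(u, c, y) = (U(x), \<mu>(x), f(x))\<close> and with
\<open>(V~\<^sub>n, \<nu>\<^sub>n, a\<^sub>n)\<close>.\<close>

lemma weighted_powr_eq:
  fixes u c y r s :: real
  assumes "0 < u" "0 < c" "0 \<le> y"
  shows "u powr (r * s - 1) / c powr (r - 1) * y powr r = c / u * (y * u powr s / c) powr r"
  using assms by (simp add: powr_mult powr_divide powr_powr powr_diff mult.commute[of r])

context half_discrete
begin

abbreviation K :: "real \<Rightarrow> nat \<Rightarrow> real" where
  "K x n \<equiv> H \<alpha> \<rho> \<gamma> \<delta> \<mu> \<nu> \<nu>t x n"

abbreviation normf :: "(real \<Rightarrow> real) \<Rightarrow> ennreal" where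
  "normf f \<equiv> fun_norm p (\<Phi> p \<delta> \<sigma> \<mu>) f"

abbreviation norma :: "(nat \<Rightarrow> real) \<Rightarrow> ennreal" where
  "norma a \<equiv> seq_norm q (\<Psi>t q \<sigma> \<nu> \<nu>t) a"

abbreviation admf :: "(real \<Rightarrow> real) \<Rightarrow> bool" where
  "admf f \<equiv> adm_fun p (\<Phi> p \<delta> \<sigma> \<mu>) f"

abbreviation adma :: "(nat \<Rightarrow> real) \<Rightarrow> bool" where
  "adma a \<equiv> adm_seq q (\<Psi>t q \<sigma> \<nu> \<nu>t) a"

abbreviation bilinear_form :: "(real \<Rightarrow> real) \<Rightarrow> (nat \<Rightarrow> real) \<Rightarrow> ennreal" where
  "bilinear_form f a \<equiv> (\<Sum>n. \<integral>\<^sup>+x\<in>{0<..}. ennreal (K x (Suc n) * a (Suc n) * f x) \<partial>lebesgue)"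

abbreviation norm_of_transform :: "(real \<Rightarrow> real) \<Rightarrow> ennreal" where
  "norm_of_transform f \<equiv> (\<Sum>n. ennreal (\<nu> (Suc n) / v n powr (1 - p * \<sigma>)) *
     (\<integral>\<^sup>+x\<in>{0<..}. ennreal (K x (Suc n) * f x) \<partial>lebesgue) epowr p) epowr (1 / p)"

abbreviation norm_of_cotransform :: "(nat \<Rightarrow> real) \<Rightarrow> ennreal" where
  "norm_of_cotransform a \<equiv> (\<integral>\<^sup>+x\<in>{0<..}. ennreal (\<mu> x / U \<mu> x powr (1 - q * \<delta> * \<sigma>)) *
     (\<Sum>n. ennreal (K x (Suc n) * a (Suc n))) epowr q \<partial>lebesgue) epowr (1 / q)"

text \<open>Dividing by \<open>\<mu> U\<^bsup>\<delta>\<sigma>-1\<^esup>\<close> and \<open>\<nu>\<^sub>n V~\<^sub>n\<^bsup>\<sigma>-1\<^esup>\<close>, respectively, removes the weights from the norms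
once the measures are \<open>m\<close> and \<open>w\<close>.\<close>

definition scaled_fun :: "(real \<Rightarrow> real) \<Rightarrow> real \<Rightarrow> real" where
  "scaled_fun f x = f x * U \<mu> x powr (1 - \<delta> * \<sigma>) / \<mu> x"

definition scaled_seq :: "(nat \<Rightarrow> real) \<Rightarrow> nat \<Rightarrow> real" where
  "scaled_seq a n = a (Suc n) * v n powr (1 - \<sigma>) / \<nu> (Suc n)"

lemma scaled_fun_nonneg: "0 < x \<Longrightarrow> 0 \<le> f x \<Longrightarrow> 0 \<le> scaled_fun f x"
  using \<mu>_pos[of x] by (simp add: scaled_fun_def)

lemma scaled_seq_nonneg: "0 \<le> a (Suc n) \<Longrightarrow> 0 \<le> scaled_seq a n"
  using \<nu>_pos[of "Suc n"] by (simp add: scaled_seq_def)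

lemma scaled_fun_measurable [measurable]:
  assumes [measurable]: "f \<in> borel_measurable halfline"
  shows "scaled_fun f \<in> borel_measurable halfline"
  unfolding scaled_fun_def[abs_def] by measurable

lemma H_eq: "K x (Suc n) = kern \<alpha> \<rho> \<gamma> (U \<mu> x powr \<delta> * v n)"
  by (simp add: H_def kern_def)

lemma G_eq: "0 < x \<Longrightarrow> G n x = U \<mu> x powr (\<delta> * \<sigma>) * v n powr \<sigma> * K x (Suc n)"
  using U_pos[of x] v_pos[of n] by (simp add: G_def H_eq powr_mult powr_powr)

lemma H_nonneg: "0 \<le> K x (Suc n)"
  using kern_nonneg[of \<rho>] \<rho> by (simp add: H_eq)

lemma \<Phi>_eq:
  assumes "0 < x" "0 \<le> f x"
  shows "\<Phi> p \<delta> \<sigma> \<mu> x * f x powr p = \<mu> x / U \<mu> x * scaled_fun f x powr p"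
  unfolding \<Phi>_def scaled_fun_def using U_pos \<mu>_pos assms by (intro weighted_powr_eq) auto

lemma \<Psi>_eq:
  assumes "0 \<le> a (Suc n)"
  shows "\<Psi>t q \<sigma> \<nu> \<nu>t (Suc n) * a (Suc n) powr q = w n * scaled_seq a n powr q"
  unfolding \<Psi>t_def scaled_seq_def w_def using v_pos \<nu>_pos assms by (intro weighted_powr_eq) auto

lemma H_f_eq:
  assumes "0 < x"
  shows "v n powr \<sigma> * (K x (Suc n) * f x) = \<mu> x / U \<mu> x * (G n x * scaled_fun f x)"
  using U_pos[of x] \<mu>_pos[of x] v_pos[of n] assms
  by (simp add: G_eq scaled_fun_def powr_diff)

lemma H_a_eq:
  assumes "0 < x"
  shows "U \<mu> x powr (\<delta> * \<sigma>) * (K x (Suc n) * a (Suc n)) = w n * G n x * scaled_seq a n"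
  using U_pos[of x] \<nu>_pos[of "Suc n"] v_pos[of n] assms
  by (simp add: G_eq scaled_seq_def w_def powr_diff)

lemma normf_eq:
  assumes "f \<in> borel_measurable halfline" "\<forall>x>0. 0 \<le> f x"
  shows "normf f = (\<integral>\<^sup>+x. ennreal (scaled_fun f x) epowr p \<partial>m) epowr (1 / p)"
proof -
  have "(\<integral>\<^sup>+x. ennreal (scaled_fun f x) epowr p \<partial>m) = (\<integral>\<^sup>+x. ennreal (\<mu> x / U \<mu> x) * ennreal (scaled_fun f x) epowr p \<partial>halfline)"
    using assms(1) by (intro nn_integral_m) measurable
  also have "\<dots> = (\<integral>\<^sup>+x. ennreal (\<Phi> p \<delta> \<sigma> \<mu> x * f x powr p) \<partial>halfline)"
  proof (intro nn_integral_cong)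
    fix x assume "x \<in> space halfline"
    then have x: "0 < x" by (simp add: space_restrict_space)
    then have fx: "0 \<le> f x" using assms(2) by simp
    show "ennreal (\<mu> x / U \<mu> x) * ennreal (scaled_fun f x) epowr p = ennreal (\<Phi> p \<delta> \<sigma> \<mu> x * f x powr p)"
      unfolding \<Phi>_eq[of x f, OF x fx] epowr_ennreal[OF scaled_fun_nonneg[of x f, OF x fx]]
      using \<mu>_nonneg[OF x] U_nonneg[OF x] by (intro ennreal_mult[symmetric]) auto
  qed
  finally have "(\<integral>\<^sup>+x. ennreal (scaled_fun f x) epowr p \<partial>m) = (\<integral>\<^sup>+x. ennreal (\<Phi> p \<delta> \<sigma> \<mu> x * f x powr p) \<partial>halfline)" .
  then show ?thesis
    by (simp add: fun_norm_def nn_integral_halfline)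
qed

lemma norma_eq:
  assumes "\<forall>n\<ge>1. 0 \<le> a n"
  shows "norma a = (\<Sum>n. ennreal (w n) * ennreal (scaled_seq a n) epowr q) epowr (1 / q)"
  using assms w_pos by (simp add: seq_norm_def \<Psi>_eq epowr_ennreal scaled_seq_nonneg ennreal_mult less_imp_le)

lemma integral_H_f:
  assumes "f \<in> borel_measurable halfline" "\<forall>x>0. 0 \<le> f x"
  shows "ennreal (v n powr \<sigma>) * (\<integral>\<^sup>+x\<in>{0<..}. ennreal (K x (Suc n) * f x) \<partial>lebesgue)
    = (\<integral>\<^sup>+x. ennreal (G n x) * ennreal (scaled_fun f x) \<partial>m)"
proof -
  have [measurable]: "(\<lambda>x. K x (Suc n)) \<in> borel_measurable halfline"
    unfolding H_eq by measurable
  have "ennreal (v n powr \<sigma>) * (\<integral>\<^sup>+x. ennreal (K x (Suc n) * f x) \<partial>halfline)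
      = (\<integral>\<^sup>+x. ennreal (v n powr \<sigma>) * ennreal (K x (Suc n) * f x) \<partial>halfline)"
    using assms(1) by (intro nn_integral_cmult[symmetric]) measurable
  also have "\<dots> = (\<integral>\<^sup>+x. ennreal (\<mu> x / U \<mu> x) * (ennreal (G n x) * ennreal (scaled_fun f x)) \<partial>halfline)"
    using assms(2) \<mu>_nonneg U_nonneg G_nonneg scaled_fun_nonneg
    by (intro nn_integral_cong)
       (simp add: space_restrict_space H_f_eq flip: ennreal_mult ennreal_mult')
  also have "\<dots> = (\<integral>\<^sup>+x. ennreal (G n x) * ennreal (scaled_fun f x) \<partial>m)"
    using assms(1) by (intro nn_integral_m[symmetric]) measurable
  finally show ?thesis
    by (simp add: nn_integral_halfline)
qed

lemma bilinear_form_eq: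
  assumes f: "f \<in> borel_measurable halfline" "\<forall>x>0. 0 \<le> f x"
    and a: "\<forall>n\<ge>1. 0 \<le> a n"
  shows "bilinear_form f a
    = (\<Sum>n. ennreal (w n) * ennreal (scaled_seq a n) * (\<integral>\<^sup>+x. ennreal (G n x) * ennreal (scaled_fun f x) \<partial>m))"
proof (intro suminf_cong)
  fix n
  have [measurable]: "(\<lambda>x. K x (Suc n)) \<in> borel_measurable halfline"
    unfolding H_eq by measurable
  have "(\<integral>\<^sup>+x. ennreal (K x (Suc n) * a (Suc n) * f x) \<partial>halfline)
      = (\<integral>\<^sup>+x. ennreal (a (Suc n)) * ennreal (K x (Suc n) * f x) \<partial>halfline)"
    using f a[rule_format, of "Suc n"] H_nonneg
    by (intro nn_integral_cong) (simp add: space_restrict_space mult_ac flip: ennreal_mult)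
  also have "\<dots> = ennreal (a (Suc n)) * (\<integral>\<^sup>+x. ennreal (K x (Suc n) * f x) \<partial>halfline)"
    using f(1) by (intro nn_integral_cmult) measurable
  also have "ennreal (a (Suc n)) = ennreal (w n) * ennreal (scaled_seq a n) * ennreal (v n powr \<sigma>)"
  proof -
    have "a (Suc n) = w n * scaled_seq a n * v n powr \<sigma>"
      using v_pos[of n] \<nu>_pos[of "Suc n"] by (simp add: w_def scaled_seq_def powr_diff)
    moreover have "0 \<le> scaled_seq a n"
      using a by (intro scaled_seq_nonneg) simp
    ultimately show ?thesis
      using w_pos[of n] by (simp add: ennreal_mult)
  qed
  also have "\<dots> * (\<integral>\<^sup>+x. ennreal (K x (Suc n) * f x) \<partial>halfline)
      = ennreal (w n) * ennreal (scaled_seq a n) * (\<integral>\<^sup>+x. ennreal (G n x) * ennreal (scaled_fun f x) \<partial>m)"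
    using integral_H_f[OF f, of n] by (simp add: mult.assoc nn_integral_halfline)
  finally show "(\<integral>\<^sup>+x\<in>{0<..}. ennreal (K x (Suc n) * a (Suc n) * f x) \<partial>lebesgue)
      = ennreal (w n) * ennreal (scaled_seq a n) * (\<integral>\<^sup>+x. ennreal (G n x) * ennreal (scaled_fun f x) \<partial>m)"
    by (simp add: nn_integral_halfline)
qed

lemma norm_of_transform_eq:
  assumes f: "f \<in> borel_measurable halfline" "\<forall>x>0. 0 \<le> f x"
  shows "norm_of_transform f
    = (\<Sum>n. ennreal (w n) * (\<integral>\<^sup>+x. ennreal (G n x) * ennreal (scaled_fun f x) \<partial>m) epowr p) epowr (1 / p)"
proof -
  have "ennreal (\<nu> (Suc n) / v n powr (1 - p * \<sigma>)) = ennreal (w n) * ennreal (v n powr \<sigma>) epowr p" for n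
    using v_pos[of n] \<nu>_pos[of "Suc n"]
    by (simp add: epowr_ennreal powr_powr w_def powr_diff mult.commute[of p] flip: ennreal_mult)
  then show ?thesis
    by (simp add: mult.assoc flip: integral_H_f[OF f] epowr_mult)
qed

lemma norm_of_cotransform_eq:
  assumes a: "\<forall>n\<ge>1. 0 \<le> a n"
  shows "norm_of_cotransform a
    = (\<integral>\<^sup>+x. (\<Sum>n. ennreal (w n) * ennreal (G n x) * ennreal (scaled_seq a n)) epowr q \<partial>m) epowr (1 / q)"
proof -
  have "(\<integral>\<^sup>+x. (\<Sum>n. ennreal (w n) * ennreal (G n x) * ennreal (scaled_seq a n)) epowr q \<partial>m)
    = (\<integral>\<^sup>+x. ennreal (\<mu> x / U \<mu> x) * (\<Sum>n. ennreal (w n) * ennreal (G n x) * ennreal (scaled_seq a n)) epowr q \<partial>halfline)"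
    by (intro nn_integral_m) measurable
  also have "\<dots> = (\<integral>\<^sup>+x. ennreal (\<mu> x / U \<mu> x powr (1 - q * \<delta> * \<sigma>)) *
     (\<Sum>n. ennreal (K x (Suc n) * a (Suc n))) epowr q \<partial>halfline)"
  proof (intro nn_integral_cong)
    fix x assume "x \<in> space halfline"
    then have x: "0 < x" by (simp add: space_restrict_space)
    have "ennreal (w n) * ennreal (G n x) * ennreal (scaled_seq a n)
        = ennreal (U \<mu> x powr (\<delta> * \<sigma>)) * ennreal (K x (Suc n) * a (Suc n))" for n
      using H_a_eq[OF x, of n a] w_pos[of n] G_nonneg[of n x] scaled_seq_nonneg[of a n] a[rule_format, of "Suc n"] H_nonneg[of x n]
      by (simp flip: ennreal_mult ennreal_mult')
    then have "(\<Sum>n. ennreal (w n) * ennreal (G n x) * ennreal (scaled_seq a n)) epowr q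
        = ennreal (U \<mu> x powr (\<delta> * \<sigma>)) epowr q * (\<Sum>n. ennreal (K x (Suc n) * a (Suc n))) epowr q"
      by (simp add: epowr_mult)
    moreover have "ennreal (\<mu> x / U \<mu> x) * ennreal (U \<mu> x powr (\<delta> * \<sigma>)) epowr q
        = ennreal (\<mu> x / U \<mu> x powr (1 - q * \<delta> * \<sigma>))"
      using U_pos[OF x] \<mu>_pos[OF x] by (simp add: epowr_ennreal powr_powr powr_diff mult_ac flip: ennreal_mult)
    ultimately show "ennreal (\<mu> x / U \<mu> x) * (\<Sum>n. ennreal (w n) * ennreal (G n x) * ennreal (scaled_seq a n)) epowr q
      = ennreal (\<mu> x / U \<mu> x powr (1 - q * \<delta> * \<sigma>)) * (\<Sum>n. ennreal (K x (Suc n) * a (Suc n))) epowr q"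
      by (simp flip: mult.assoc)
  qed
  finally show ?thesis
    by (simp add: nn_integral_halfline)
qed

lemma adm_funD:
  assumes "admf f"
  shows "f \<in> borel_measurable halfline" "\<forall>x>0. 0 \<le> f x"
    "0 < (\<integral>\<^sup>+x. ennreal (scaled_fun f x) epowr p \<partial>m)" "(\<integral>\<^sup>+x. ennreal (scaled_fun f x) epowr p \<partial>m) < top"
  using assms normf_eq[of f] by (auto simp: adm_fun_def zero_less_iff_neq_zero less_top[symmetric])

lemma adm_seqD:
  assumes "adma a"
  shows "\<forall>n\<ge>1. 0 \<le> a n"
    "0 < (\<Sum>n. ennreal (w n) * ennreal (scaled_seq a n) epowr q)" "(\<Sum>n. ennreal (w n) * ennreal (scaled_seq a n) epowr q) < top"
  using assms norma_eq[of a] by (auto simp: adm_seq_def zero_less_iff_neq_zero less_top[symmetric])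

theorem transform_bound: "admf f \<Longrightarrow> norm_of_transform f < ennreal k * normf f"
  using sum_integral_power_less[OF p, of "\<lambda>x. ennreal (scaled_fun f x)"] adm_funD[of f]
  by (simp add: norm_of_transform_eq normf_eq measurable_m_iff)

theorem cotransform_bound: "adma a \<Longrightarrow> norm_of_cotransform a < ennreal k * norma a"
  using integral_sum_power_less[OF q, of "\<lambda>n. ennreal (scaled_seq a n)"] adm_seqD[of a]
  by (simp add: norm_of_cotransform_eq norma_eq)

text \<open>The Hoelder inequality for the sum over \<open>n\<close> with weights \<open>w\<close>.\<close>

lemma bilinear_form_le_transform:
  assumes "admf f" "adma a"
  shows "bilinear_form f a \<le> norm_of_transform f * norma a"
proof -
  note f = adm_funD[OF assms(1)] and a = adm_seqD[OF assms(2)]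
  let ?T = "\<lambda>n. \<integral>\<^sup>+x. ennreal (G n x) * ennreal (scaled_fun f x) \<partial>m"
  let ?N = "density (count_space UNIV) (\<lambda>n. ennreal (w n))"
  have N: "(\<integral>\<^sup>+n. h n \<partial>?N) = (\<Sum>n. ennreal (w n) * h n)" for h
    by (subst nn_integral_density) (auto simp: nn_integral_count_space_nat)
  have "(\<integral>\<^sup>+n. ?T n * ennreal (scaled_seq a n) \<partial>?N)
      \<le> (\<integral>\<^sup>+n. ?T n epowr p \<partial>?N) epowr (1 / p) * (\<integral>\<^sup>+n. ennreal (scaled_seq a n) epowr q \<partial>?N) epowr (1 / q)"
    using p q pq by (intro nn_integral_Hoelder) auto
  also have "(\<integral>\<^sup>+n. ?T n * ennreal (scaled_seq a n) \<partial>?N) = bilinear_form f a"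
    unfolding N bilinear_form_eq[OF f(1,2) a(1)] by (simp add: mult_ac)
  finally show ?thesis
    by (simp only: N norm_of_transform_eq[OF f(1,2)] norma_eq[OF a(1)])
qed

text \<open>Exchange sum and integral, then apply the Hoelder inequality with respect to \<open>m\<close>.\<close>

lemma bilinear_form_le_cotransform:
  assumes "admf f" "adma a"
  shows "bilinear_form f a \<le> norm_of_cotransform a * normf f"
proof -
  note f = adm_funD[OF assms(1)] and a = adm_seqD[OF assms(2)]
  have [measurable]: "(\<lambda>x. ennreal (scaled_fun f x)) \<in> borel_measurable m"
    unfolding measurable_m_iff using f(1) by measurable
  have "bilinear_form f a
      = (\<Sum>n. ennreal (w n) * ennreal (scaled_seq a n) * (\<integral>\<^sup>+x. ennreal (G n x) * ennreal (scaled_fun f x) \<partial>m))"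
    by (rule bilinear_form_eq[OF f(1,2) a(1)])
  also have "\<dots> = (\<Sum>n. \<integral>\<^sup>+x. ennreal (w n) * ennreal (scaled_seq a n) * (ennreal (G n x) * ennreal (scaled_fun f x)) \<partial>m)"
    by (intro suminf_cong nn_integral_cmult[symmetric]) measurable
  also have "\<dots> = (\<Sum>n. \<integral>\<^sup>+x. ennreal (w n) * ennreal (G n x) * ennreal (scaled_seq a n) * ennreal (scaled_fun f x) \<partial>m)"
    by (simp only: mult_ac)
  also have "\<dots> = (\<integral>\<^sup>+x. (\<Sum>n. ennreal (w n) * ennreal (G n x) * ennreal (scaled_seq a n) * ennreal (scaled_fun f x)) \<partial>m)"
    by (intro nn_integral_suminf[symmetric]) measurable
  also have "\<dots> = (\<integral>\<^sup>+x. (\<Sum>n. ennreal (w n) * ennreal (G n x) * ennreal (scaled_seq a n)) * ennreal (scaled_fun f x) \<partial>m)"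
    by simp
  also have "\<dots> \<le> (\<integral>\<^sup>+x. (\<Sum>n. ennreal (w n) * ennreal (G n x) * ennreal (scaled_seq a n)) epowr q \<partial>m) epowr (1 / q)
      * (\<integral>\<^sup>+x. ennreal (scaled_fun f x) epowr p \<partial>m) epowr (1 / p)"
    using p q pq by (intro nn_integral_Hoelder) auto
  finally show ?thesis
    by (simp only: norm_of_cotransform_eq[OF a(1)] normf_eq[OF f(1,2)])
qed

lemma adm_norm_pos_finite:
  "admf f \<Longrightarrow> 0 < normf f \<and> normf f < top" "adma a \<Longrightarrow> 0 < norma a \<and> norma a < top"
  by (auto simp: adm_fun_def adm_seq_def)

lemma bilinear_form_less_if_transform_less:
  assumes "admf f" "adma a" "norm_of_transform f < ennreal C * normf f"
  shows "bilinear_form f a < ennreal C * normf f * norma a"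
  using bilinear_form_le_transform[OF assms(1,2)] ennreal_mult_strict_right_mono[OF assms(3)]
    adm_norm_pos_finite(2)[OF assms(2)] by (meson le_less_trans)

lemma bilinear_form_less_if_cotransform_less:
  assumes "admf f" "adma a" "norm_of_cotransform a < ennreal C * norma a"
  shows "bilinear_form f a < ennreal C * normf f * norma a"
proof -
  have "bilinear_form f a < ennreal C * norma a * normf f"
    using bilinear_form_le_cotransform[OF assms(1,2)] ennreal_mult_strict_right_mono[OF assms(3)]
      adm_norm_pos_finite(1)[OF assms(1)] by (meson le_less_trans)
  then show ?thesis
    by (simp add: mult_ac)
qed

end

section \<open>Sharpness of the constant\<close>

text \<open>The convex function \<open>t\<^bsup>-\<epsilon>\<^esup>\<close> lies above its tangent at \<open>x\<close>.  Read with \<open>y < x\<close> or with \<open>y > x\<close>, this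
bounds a term of the series of \<open>\<nu>\<^sub>n V\<^sub>n\<^bsup>-1-\<epsilon>\<^esup>\<close> from above or from below by a telescoping difference.\<close>

lemma powr_tangent:
  fixes x y \<epsilon> :: real
  assumes "0 < x" "0 < y" "0 < \<epsilon>"
  shows "x powr (- \<epsilon>) - y powr (- \<epsilon>) \<le> \<epsilon> * x powr (- 1 - \<epsilon>) * (y - x)"
proof -
  have "ln (y / x) \<le> y / x - 1"
    using assms by (intro ln_le_minus_one) auto
  then have "1 - \<epsilon> * (y / x - 1) \<le> 1 + - \<epsilon> * ln (y / x)"
    using assms by simp
  also have "\<dots> \<le> exp (- \<epsilon> * ln (y / x))"
    by (rule exp_ge_add_one_self)
  also have "\<dots> = y powr (- \<epsilon>) / x powr (- \<epsilon>)"
    using assms by (simp add: powr_def ln_div right_diff_distrib flip: exp_diff)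
  finally have "x powr (- \<epsilon>) * (1 - \<epsilon> * (y / x - 1)) \<le> y powr (- \<epsilon>)"
    using assms by (simp add: le_divide_eq mult.commute)
  moreover have "x powr (- 1 - \<epsilon>) = x powr (- \<epsilon>) / x"
    using assms by (simp add: powr_diff powr_minus divide_simps)
  ultimately show ?thesis
    using assms by (simp add: algebra_simps diff_divide_distrib)
qed

locale half_discrete_divergent = half_discrete +
  assumes decreasing: "\<exists>n0\<ge>1. \<forall>n\<ge>n0. \<nu> n \<ge> \<nu> (Suc n)"
    and V_inf: "V_inf \<nu> = \<infinity>"
begin

abbreviation P :: "nat \<Rightarrow> real" where "P \<equiv> partial_sum \<nu>"

lemma P_mono: "i \<le> j \<Longrightarrow> P i \<le> P j"
  by (rule lift_Suc_mono_le[of P, OF less_imp_le[OF partial_sum_strict_mono]])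

lemma P_pos: "0 < P (Suc n)"
  using partial_sum_strict_mono[of n] partial_sum_nonneg[of n] by simp

lemma P_at_top: "filterlim P at_top sequentially"
  unfolding filterlim_at_top
proof
  fix B :: real
  have "\<exists>n. B \<le> P n"
  proof (rule ccontr)
    assume "\<not> ?thesis"
    then have B: "P n \<le> B" for n
      by (meson linear)
    have "(\<Sum>i<n. ennreal (\<nu> (Suc i))) = ennreal (P n)" for n
    proof (induction n)
      case (Suc n)
      then show ?case
        using partial_sum_nonneg[of n] \<nu>_pos[of "Suc n"] by (simp add: partial_sum_Suc ennreal_plus)
    qed (simp add: partial_sum_def)
    then have "V_inf \<nu> = (SUP n. ennreal (P n))"
      unfolding V_inf_def by (simp add: suminf_eq_SUP)
    also have "\<dots> \<le> ennreal B"
      using B by (intro SUP_least ennreal_leI)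
    finally show False
      using V_inf by (simp add: top_unique)
  qed
  then obtain n where "B \<le> P n" ..
  then show "eventually (\<lambda>n. B \<le> P n) sequentially"
    using P_mono by (auto simp: eventually_sequentially intro: order.trans)
qed

text \<open>The terms of \<open>\<Sum>\<^sub>n w\<^sub>n A\<^sub>n\<^sup>q\<close> for the test sequence \<open>A\<^sub>n = V~\<^sub>n\<^bsup>-\<epsilon>/q\<^esup>\<close> cut off below \<open>N\<close>.\<close>

definition tail :: "nat \<Rightarrow> real \<Rightarrow> nat \<Rightarrow> real" where
  "tail N \<epsilon> n = (if N \<le> n then w n * v n powr (- \<epsilon>) else 0)"

lemma tail_nonneg: "0 \<le> tail N \<epsilon> n"
  using w_pos[of n] by (simp add: tail_def)

lemma w_v_powr: "w n * v n powr (- \<epsilon>) = \<nu> (Suc n) * v n powr (- 1 - \<epsilon>)"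
  using v_pos[of n] by (simp add: w_def powr_diff powr_minus divide_simps)

text \<open>As \<open>V~\<^sub>n \<ge> V\<^sub>n/2\<close>, the terms are dominated by a multiple of
\<open>V\<^bsub>n-1\<^esub>\<^sup>-\<^sup>\<epsilon> - V\<^sub>n\<^sup>-\<^sup>\<epsilon>\<close>, which telescopes.  The condition \<open>0 < N\<close> keeps \<open>V\<^sub>0 = 0\<close> out of the
negative powers.\<close>

lemma tail_summable:
  assumes "0 < \<epsilon>" "0 < N"
  shows "summable (tail N \<epsilon>)"
proof (rule summableI_nonneg_bounded)
  define C where "C = 2 powr (1 + \<epsilon>) / \<epsilon>"
  have C: "0 \<le> C" using assms by (simp add: C_def)
  have step: "tail N \<epsilon> n \<le> C * (P n powr (- \<epsilon>) - P (Suc n) powr (- \<epsilon>))" if n: "N \<le> n" for n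
  proof -
    obtain i where i: "n = Suc i"
      using n assms by (cases n) auto
    have Pn: "0 < P n" "0 < P (Suc n)"
      using P_pos by (auto simp: i)
    have "P (Suc n) / 2 \<le> v n"
      using v_ge_midpoint[of n] Pn by simp
    then have "v n powr (- 1 - \<epsilon>) \<le> (P (Suc n) / 2) powr (- 1 - \<epsilon>)"
      using Pn assms by (intro powr_mono2') auto
    also have "\<dots> = 2 powr (1 + \<epsilon>) * P (Suc n) powr (- 1 - \<epsilon>)"
      using Pn by (simp add: powr_divide powr_minus_divide[of 2 "1 + \<epsilon>", simplified])
    finally have "tail N \<epsilon> n \<le> \<nu> (Suc n) * (2 powr (1 + \<epsilon>) * P (Suc n) powr (- 1 - \<epsilon>))"
      unfolding tail_def w_v_powr using n \<nu>_pos[of "Suc n"] by simp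
    moreover have "\<epsilon> * P (Suc n) powr (- 1 - \<epsilon>) * \<nu> (Suc n) \<le> P n powr (- \<epsilon>) - P (Suc n) powr (- \<epsilon>)"
      using powr_tangent[of "P (Suc n)" "P n" \<epsilon>] Pn assms by (simp add: partial_sum_Suc)
    then have "2 powr (1 + \<epsilon>) / \<epsilon> * (\<epsilon> * P (Suc n) powr (- 1 - \<epsilon>) * \<nu> (Suc n)) \<le> C * (P n powr (- \<epsilon>) - P (Suc n) powr (- \<epsilon>))"
      unfolding C_def using assms by (intro mult_left_mono) auto
    ultimately show ?thesis
      using assms by (simp add: mult_ac)
  qed
  have "sum (tail N \<epsilon>) {..<n} \<le> C * (P N powr (- \<epsilon>) - P (max N n) powr (- \<epsilon>))" for n
  proof (induction n)
    case (Suc n)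
    show ?case
    proof (cases "N \<le> n")
      case True
      then have "max N n = n" "max N (Suc n) = Suc n" by auto
      with Suc step[OF True] show ?thesis by (simp add: algebra_simps)
    next
      case False
      then have "max N n = N" "max N (Suc n) = N" "tail N \<epsilon> n = 0" by (auto simp: tail_def)
      with Suc show ?thesis by simp
    qed
  qed simp
  also have "C * (P N powr (- \<epsilon>) - P (max N n) powr (- \<epsilon>)) \<le> C * P N powr (- \<epsilon>)" for n
    using C by (intro mult_left_mono) auto
  finally show "sum (tail N \<epsilon>) {..<n} \<le> C * P N powr (- \<epsilon>)" for n .
qed (rule tail_nonneg)

text \<open>Here the monotonicity of \<open>\<nu>\<close> is needed: replacing \<open>\<nu>\<^sub>n\<close> by the smaller \<open>\<nu>\<^bsub>n+1\<^esub>\<close> makes the terms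
comparable with \<open>V\<^sub>n\<^sup>-\<^sup>\<epsilon> - V\<^bsub>n+1\<^esub>\<^sup>-\<^sup>\<epsilon>\<close>.  The telescoping sum keeps only its first term, because
\<open>V\<^sub>n\<close> tends to infinity.\<close>

lemma tail_sum_ge:
  assumes "0 < \<epsilon>" "0 < N" and dec: "\<And>n. N \<le> n \<Longrightarrow> \<nu> (Suc (Suc n)) \<le> \<nu> (Suc n)"
  shows "P (Suc N) powr (- \<epsilon>) \<le> \<epsilon> * suminf (tail N \<epsilon>)"
proof -
  have step: "P (Suc n) powr (- \<epsilon>) - P (Suc (Suc n)) powr (- \<epsilon>) \<le> \<epsilon> * tail N \<epsilon> n" if n: "N \<le> n" for n
  proof -
    have "P (Suc n) powr (- \<epsilon>) - P (Suc (Suc n)) powr (- \<epsilon>) \<le> \<epsilon> * P (Suc n) powr (- 1 - \<epsilon>) * \<nu> (Suc (Suc n))"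
      using powr_tangent[OF P_pos[of n] P_pos[of "Suc n"] assms(1)] by (simp add: partial_sum_Suc)
    also have "\<dots> \<le> \<epsilon> * v n powr (- 1 - \<epsilon>) * \<nu> (Suc n)"
      using assms(1) v_pos[of n] v_le[of n] dec[OF n] \<nu>_pos[of "Suc (Suc n)"]
      by (intro mult_mono mult_left_mono powr_mono2') auto
    also have "\<dots> = \<epsilon> * tail N \<epsilon> n"
      using n by (simp add: tail_def w_v_powr)
    finally show ?thesis .
  qed
  have "P (Suc N) powr (- \<epsilon>) - P (Suc (N + j)) powr (- \<epsilon>) \<le> \<epsilon> * sum (tail N \<epsilon>) {N..<N + j}" for j
  proof (induction j)
    case (Suc j)
    then show ?case
      using step[of "N + j"] by (simp add: algebra_simps)
  qed simp
  also have "\<epsilon> * sum (tail N \<epsilon>) {N..<N + j} \<le> \<epsilon> * suminf (tail N \<epsilon>)" for j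
    using assms tail_summable[of \<epsilon> N] tail_nonneg by (intro mult_left_mono sum_le_suminf) auto
  finally have le: "P (Suc N) powr (- \<epsilon>) - P (Suc (N + j)) powr (- \<epsilon>) \<le> \<epsilon> * suminf (tail N \<epsilon>)" for j .
  have "filterlim (\<lambda>j. P (Suc (N + j))) at_top sequentially"
    by (rule filterlim_compose[OF P_at_top], rule filterlim_subseq) (simp add: strict_mono_def)
  then have "(\<lambda>j. P (Suc (N + j)) powr (- \<epsilon>)) \<longlonglongrightarrow> 0"
    using assms(1) by (intro tendsto_neg_powr) auto
  then have "(\<lambda>j. P (Suc N) powr (- \<epsilon>) - P (Suc (N + j)) powr (- \<epsilon>)) \<longlonglongrightarrow> P (Suc N) powr (- \<epsilon>) - 0"
    by (intro tendsto_intros)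
  then show ?thesis
    using LIMSEQ_le_const2 le by fastforce
qed

definition cut_powr :: "real \<Rightarrow> real \<Rightarrow> real" where
  "cut_powr e y = (if y \<le> 1 then y powr e else 0)"

text \<open>The near-extremisers, chosen so that their rescaled forms are \<open>y\<^bsup>\<epsilon>/p\<^esup>\<close> on \<open>y \<le> 1\<close> and
\<open>V~\<^sub>n\<^bsup>-\<epsilon>/q\<^esup>\<close> for \<open>n > N\<close>; for \<open>\<epsilon> = 0\<close> both norms would diverge logarithmically.\<close>

definition test_f :: "real \<Rightarrow> real \<Rightarrow> real" where
  "test_f \<epsilon> x = cut_powr (\<epsilon> / p) (U \<mu> x powr \<delta>) * U \<mu> x powr (\<delta> * \<sigma> - 1) * \<mu> x"

definition test_a :: "nat \<Rightarrow> real \<Rightarrow> nat \<Rightarrow> real" where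
  "test_a N \<epsilon> n = (if N < n then Vt \<nu> \<nu>t n powr (\<sigma> - 1 - \<epsilon> / q) * \<nu> n else 0)"

lemma cut_powr_nonneg: "0 \<le> cut_powr e y"
  by (simp add: cut_powr_def)

lemma cut_powr_measurable [measurable]: "cut_powr e \<in> borel_measurable borel"
  unfolding cut_powr_def[abs_def] by measurable

lemma test_f_measurable [measurable]: "test_f \<epsilon> \<in> borel_measurable halfline"
  unfolding test_f_def[abs_def] by measurable

lemma test_f_nonneg: "\<forall>x>0. 0 \<le> test_f \<epsilon> x"
  using \<mu>_nonneg by (simp add: test_f_def cut_powr_nonneg)

lemma test_a_nonneg: "\<forall>n\<ge>1. 0 \<le> test_a N \<epsilon> n"
  using \<nu>_pos by (simp add: test_a_def less_imp_le)

lemma scaled_fun_test_f: "0 < x \<Longrightarrow> scaled_fun (test_f \<epsilon>) x = cut_powr (\<epsilon> / p) (U \<mu> x powr \<delta>)"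
  using U_pos[of x] \<mu>_pos[of x] by (simp add: scaled_fun_def test_f_def powr_diff)

lemma scaled_seq_test_a: "scaled_seq (test_a N \<epsilon>) n = (if N \<le> n then v n powr (- \<epsilon> / q) else 0)"
  using v_pos[of n] \<nu>_pos[of "Suc n"] by (simp add: scaled_seq_def test_a_def powr_diff powr_minus_divide)

text \<open>After substituting \<open>t = U(x)\<^sup>\<delta>\<close>, the \<open>p\<close>-th power of the norm is the integral of \<open>t\<^bsup>\<epsilon>-1\<^esup>\<close> over
\<open>[0, 1]\<close>.\<close>

lemma normf_test_f:
  assumes "0 < \<epsilon>"
  shows "normf (test_f \<epsilon>) = ennreal (1 / \<epsilon>) epowr (1 / p)"
proof -
  define F where "F t = (if t \<le> 1 then t powr \<epsilon> else 0)" for t :: real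
  have "((\<lambda>t. t powr (\<epsilon> - 1)) has_integral (1 / \<epsilon>)) {0..1}"
    using has_integral_powr_from_0[of "\<epsilon> - 1" 1] assms by simp
  then have "((\<lambda>t. if t \<in> {0..1} then t powr (\<epsilon> - 1) else 0) has_integral (1 / \<epsilon>)) UNIV"
    by (simp only: has_integral_restrict_UNIV)
  also have "(\<lambda>t. if t \<in> {0..1} then t powr (\<epsilon> - 1) else 0) = (\<lambda>t. if t \<in> {0<..} then F t / t else 0)"
    by (auto simp: F_def powr_diff fun_eq_iff)
  finally have F: "((\<lambda>t. F t / t) has_integral (1 / \<epsilon>)) {0<..}"
    by (simp only: has_integral_restrict_UNIV)
  have "(\<integral>\<^sup>+x. ennreal (scaled_fun (test_f \<epsilon>) x) epowr p \<partial>m)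
      = (\<integral>\<^sup>+x. ennreal (\<mu> x / U \<mu> x) * ennreal (scaled_fun (test_f \<epsilon>) x) epowr p \<partial>halfline)"
    by (intro nn_integral_m) measurable
  also have "\<dots> = (\<integral>\<^sup>+x. ennreal (\<mu> x / U \<mu> x * F (U \<mu> x powr \<delta> * 1)) \<partial>halfline)"
  proof (intro nn_integral_cong)
    fix x assume "x \<in> space halfline"
    then have x: "0 < x" by (simp add: space_restrict_space)
    have "ennreal (scaled_fun (test_f \<epsilon>) x) epowr p = ennreal (F (U \<mu> x powr \<delta>))"
      using p by (auto simp: scaled_fun_test_f[OF x] cut_powr_def F_def epowr_ennreal powr_powr)
    then show "ennreal (\<mu> x / U \<mu> x) * ennreal (scaled_fun (test_f \<epsilon>) x) epowr p = ennreal (\<mu> x / U \<mu> x * F (U \<mu> x powr \<delta> * 1))"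
      using \<mu>_nonneg[OF x] U_nonneg[OF x] by (simp add: ennreal_mult' del: times_divide_eq_left)
  qed
  also have "\<dots> = (\<integral>\<^sup>+t. ennreal (F t / t) \<partial>halfline)"
    using F by (intro nn_integral_powr_U \<delta>) (auto simp: F_def)
  also have "\<dots> = ennreal (1 / \<epsilon>)"
    using F nn_integral_lebesgue_on_eq_integral[of "{0<..}" "\<lambda>t. F t / t"]
    by (auto simp: F_def integral_unique has_integral_integrable)
  finally show ?thesis
    by (simp add: normf_eq test_f_measurable test_f_nonneg)
qed

lemma norma_test_a:
  assumes "0 < \<epsilon>" "0 < N"
  shows "norma (test_a N \<epsilon>) = ennreal (suminf (tail N \<epsilon>)) epowr (1 / q)"
proof -
  have "ennreal (w n) * ennreal (scaled_seq (test_a N \<epsilon>) n) epowr q = ennreal (tail N \<epsilon> n)" for n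
    using q w_pos[of n] by (simp add: scaled_seq_test_a tail_def epowr_ennreal powr_powr ennreal_mult less_imp_le)
  then show ?thesis
    using tail_summable[OF assms] tail_nonneg
    by (simp add: norma_eq test_a_nonneg suminf_ennreal2)
qed

text \<open>With \<open>t = y V~\<^sub>n\<close>, only the range \<open>\<tau> \<le> t \<le> T\<close> is kept.  There \<open>y \<le> T / V~\<^sub>n \<le> 1\<close>, so the cutoff in the test
function is not felt, and \<open>y \<ge> \<tau> / V~\<^sub>n\<close> bounds \<open>y\<^bsup>\<epsilon>/p\<^esup>\<close> from below.\<close>

lemma integral_G_test_f_ge:
  assumes "0 < \<epsilon>" and \<tau>: "0 < \<tau>" "\<tau> \<le> T" "T \<le> v n"
  shows "ennreal ((\<tau> / v n) powr (\<epsilon> / p) * integral {\<tau>..T} g)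
    \<le> (\<integral>\<^sup>+x. ennreal (G n x) * ennreal (scaled_fun (test_f \<epsilon>) x) \<partial>m)"
proof -
  define c where "c = (\<tau> / v n) powr (\<epsilon> / p)"
  define F where "F t = (if t \<in> {\<tau>..T} then c * (t powr \<sigma> * kern \<alpha> \<rho> \<gamma> t) else 0)" for t
  have c: "0 \<le> c" by (simp add: c_def)
  have F_nonneg: "0 \<le> F t" for t
    using c kern_nonneg[of \<rho>] \<rho> by (simp add: F_def)
  have "set_integrable lebesgue {\<tau>..T} g"
    by (rule set_integrable_subset[OF set_integrable_g]) (use \<tau> in auto)
  then have "g integrable_on {\<tau>..T}"
    by (rule set_lebesgue_integral_eq_integral(1))
  then have "((\<lambda>t. c * g t) has_integral c * integral {\<tau>..T} g) {\<tau>..T}"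
    by (intro has_integral_mult_right integrable_integral)
  then have "((\<lambda>t. if t \<in> {\<tau>..T} then c * g t else 0) has_integral c * integral {\<tau>..T} g) UNIV"
    by (simp only: has_integral_restrict_UNIV)
  also have "(\<lambda>t. if t \<in> {\<tau>..T} then c * g t else 0) = (\<lambda>t. if t \<in> {0<..} then F t / t else 0)"
    using \<tau> by (auto simp: F_def g_def powr_diff fun_eq_iff)
  finally have F: "((\<lambda>t. F t / t) has_integral c * integral {\<tau>..T} g) {0<..}"
    by (simp only: has_integral_restrict_UNIV)
  have "ennreal (c * integral {\<tau>..T} g) = (\<integral>\<^sup>+t. ennreal (F t / t) \<partial>halfline)"
    using F F_nonneg nn_integral_lebesgue_on_eq_integral[of "{0<..}" "\<lambda>t. F t / t"]
    by (auto simp: integral_unique has_integral_integrable)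
  also have "\<dots> = (\<integral>\<^sup>+x. ennreal (\<mu> x / U \<mu> x * F (U \<mu> x powr \<delta> * v n)) \<partial>halfline)"
    using F F_nonneg by (intro nn_integral_powr_U[symmetric] \<delta> v_pos) auto
  also have "\<dots> \<le> (\<integral>\<^sup>+x. ennreal (\<mu> x / U \<mu> x) * (ennreal (G n x) * ennreal (scaled_fun (test_f \<epsilon>) x)) \<partial>halfline)"
  proof (intro nn_integral_mono)
    fix x assume "x \<in> space halfline"
    then have x: "0 < x" by (simp add: space_restrict_space)
    define y where "y = U \<mu> x powr \<delta>"
    have y: "0 < y" using U_pos[OF x] by (simp add: y_def)
    have "F (y * v n) \<le> G n x * cut_powr (\<epsilon> / p) y"
    proof (cases "y * v n \<in> {\<tau>..T}")
      case True
      then have yv: "y * v n \<le> T" "\<tau> \<le> y * v n"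
        by simp_all
      have "y * v n \<le> 1 * v n"
        unfolding mult_1 by (rule order.trans[OF yv(1) \<tau>(3)])
      then have "y \<le> 1"
        using v_pos[of n] by (simp only: mult_le_cancel_right_pos)
      moreover have "\<tau> / v n \<le> y"
        using yv(2) v_pos[of n] by (simp add: divide_le_eq)
      ultimately have "y \<le> 1" "c \<le> y powr (\<epsilon> / p)"
        using v_pos[of n] assms(1) \<tau> p unfolding c_def by (auto intro!: powr_mono2)
      then have "c * G n x \<le> cut_powr (\<epsilon> / p) y * G n x"
        using G_nonneg by (intro mult_right_mono) (auto simp: cut_powr_def)
      with True show ?thesis
        by (simp add: F_def G_def y_def[symmetric] mult_ac)
    next
      case False
      then have "F (y * v n) = 0"
        unfolding F_def by (rule if_not_P)
      then show ?thesis
        using G_nonneg[of n x] cut_powr_nonneg by simp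
    qed
    then have "\<mu> x / U \<mu> x * F (y * v n) \<le> \<mu> x / U \<mu> x * (G n x * cut_powr (\<epsilon> / p) y)"
      using \<mu>_nonneg[OF x] U_nonneg[OF x] by (intro mult_left_mono) auto
    then have "ennreal (\<mu> x / U \<mu> x * F (y * v n)) \<le> ennreal (\<mu> x / U \<mu> x * (G n x * cut_powr (\<epsilon> / p) y))"
      by (rule ennreal_leI)
    also have "\<dots> = ennreal (\<mu> x / U \<mu> x) * (ennreal (G n x) * ennreal (cut_powr (\<epsilon> / p) y))"
      using \<mu>_nonneg[OF x] U_nonneg[OF x] G_nonneg[of n x] cut_powr_nonneg[of "\<epsilon> / p" y]
      by (simp only: ennreal_mult mult_nonneg_nonneg divide_nonneg_nonneg)
    finally show "ennreal (\<mu> x / U \<mu> x * F (U \<mu> x powr \<delta> * v n))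
      \<le> ennreal (\<mu> x / U \<mu> x) * (ennreal (G n x) * ennreal (scaled_fun (test_f \<epsilon>) x))"
      by (simp only: scaled_fun_test_f[OF x] y_def)
  qed
  also have "\<dots> = (\<integral>\<^sup>+x. ennreal (G n x) * ennreal (scaled_fun (test_f \<epsilon>) x) \<partial>m)"
    by (intro nn_integral_m[symmetric]) measurable
  finally show ?thesis
    by (simp only: c_def)
qed

text \<open>The factors \<open>V~\<^sub>n\<^bsup>-\<epsilon>/p\<^esup>\<close> and \<open>V~\<^sub>n\<^bsup>-\<epsilon>/q\<^esup>\<close> combine to \<open>V~\<^sub>n\<^sup>-\<^sup>\<epsilon>\<close>, because \<open>1/p + 1/q = 1\<close>.\<close>

lemma bilinear_form_test_ge:
  assumes "0 < \<epsilon>" "0 < N" and \<tau>: "0 < \<tau>" "\<tau> \<le> T" and T: "\<And>n. N \<le> n \<Longrightarrow> T \<le> v n"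
  shows "ennreal (\<tau> powr (\<epsilon> / p) * integral {\<tau>..T} g * suminf (tail N \<epsilon>))
    \<le> bilinear_form (test_f \<epsilon>) (test_a N \<epsilon>)"
proof -
  define c where "c = \<tau> powr (\<epsilon> / p) * integral {\<tau>..T} g"
  have "0 \<le> integral {\<tau>..T} g"
    using g_nonneg integral_nonneg integrable_subinterval set_integrable_g
    by (metis (full_types) not_integrable_integral order_refl)
  then have c: "0 \<le> c"
    by (simp add: c_def)
  have "ennreal (c * suminf (tail N \<epsilon>)) = (\<Sum>n. ennreal (c * tail N \<epsilon> n))"
    using tail_summable[OF assms(1,2)] tail_nonneg c
    by (simp add: suminf_ennreal2 summable_mult suminf_mult)
  also have "\<dots> \<le> (\<Sum>n. ennreal (w n) * ennreal (scaled_seq (test_a N \<epsilon>) n)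
      * (\<integral>\<^sup>+x. ennreal (G n x) * ennreal (scaled_fun (test_f \<epsilon>) x) \<partial>m))"
  proof (intro suminf_le)
    fix n
    show "ennreal (c * tail N \<epsilon> n) \<le> ennreal (w n) * ennreal (scaled_seq (test_a N \<epsilon>) n)
      * (\<integral>\<^sup>+x. ennreal (G n x) * ennreal (scaled_fun (test_f \<epsilon>) x) \<partial>m)"
    proof (cases "N \<le> n")
      case True
      have "- \<epsilon> / q + - \<epsilon> / p = - \<epsilon> * (1 / p + 1 / q)"
        by (simp add: distrib_left)
      then have "v n powr (- \<epsilon>) = v n powr (- \<epsilon> / q + - \<epsilon> / p)"
        by (simp only: pq mult_1_right)
      also have "\<dots> = v n powr (- \<epsilon> / q) * v n powr (- \<epsilon> / p)"
        by (rule powr_add)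
      also have "v n powr (- \<epsilon> / p) = 1 / v n powr (\<epsilon> / p)"
        by (simp add: powr_minus_divide)
      finally have "c * tail N \<epsilon> n = w n * scaled_seq (test_a N \<epsilon>) n * ((\<tau> / v n) powr (\<epsilon> / p) * integral {\<tau>..T} g)"
        using True \<tau> v_pos[of n] by (simp add: tail_def c_def scaled_seq_test_a powr_divide)
      then have "ennreal (c * tail N \<epsilon> n) = ennreal (w n) * ennreal (scaled_seq (test_a N \<epsilon>) n)
          * ennreal ((\<tau> / v n) powr (\<epsilon> / p) * integral {\<tau>..T} g)"
        using w_pos[of n] by (simp add: ennreal_mult' scaled_seq_test_a)
      also have "\<dots> \<le> ennreal (w n) * ennreal (scaled_seq (test_a N \<epsilon>) n)
          * (\<integral>\<^sup>+x. ennreal (G n x) * ennreal (scaled_fun (test_f \<epsilon>) x) \<partial>m)"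
        using assms(1) \<tau> T[OF True] by (intro mult_left_mono integral_G_test_f_ge) auto
      finally show ?thesis .
    qed (simp add: tail_def)
  qed auto
  also have "\<dots> = bilinear_form (test_f \<epsilon>) (test_a N \<epsilon>)"
    by (intro bilinear_form_eq[symmetric] test_f_measurable test_f_nonneg test_a_nonneg)
  finally show ?thesis
    by (simp only: c_def)
qed

text \<open>With \<open>I\<close> the truncated integral and \<open>S\<close> the tail sum, the test functions give
\<open>\<tau>\<^bsup>\<epsilon>/p\<^esup> I S \<le> c \<epsilon>\<^bsup>-1/p\<^esup> S\<^bsup>1/q\<^esup>\<close>, that is \<open>\<tau>\<^bsup>\<epsilon>/p\<^esup> I (\<epsilon> S)\<^bsup>1/p\<^esup> \<le> c\<close>.
Since \<open>\<epsilon> S\<close> is at least \<open>V\<^bsub>N+1\<^esub>\<^sup>-\<^sup>\<epsilon>\<close> with \<open>N\<close> independent of \<open>\<epsilon>\<close>, letting \<open>\<epsilon>\<close> tend to \<open>0\<close> gives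
\<open>I \<le> c\<close>.\<close>

lemma truncated_integral_le:
  assumes bound: "\<And>f a. admf f \<Longrightarrow> adma a \<Longrightarrow> bilinear_form f a < ennreal c * normf f * norma a"
    and c: "0 \<le> c" and \<tau>: "0 < \<tau>" "\<tau> \<le> T"
  shows "integral {\<tau>..T} g \<le> c"
proof -
  obtain n0 where n0: "\<And>n. n0 \<le> n \<Longrightarrow> \<nu> (Suc n) \<le> \<nu> n"
    using decreasing by blast
  have "eventually (\<lambda>n. 2 * T \<le> P n) sequentially"
    using P_at_top by (simp add: filterlim_at_top)
  then obtain n1 where n1: "\<And>n. n1 \<le> n \<Longrightarrow> 2 * T \<le> P n"
    by (auto simp: eventually_sequentially)
  \<comment> \<open>Beyond \<open>N\<close> the sequence \<open>\<nu>\<close> decreases and \<open>V~\<^sub>n \<ge> T\<close>.\<close>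
  define N where "N = Suc (max n0 n1)"
  have N: "0 < N" "n0 \<le> N" "n1 \<le> N"
    by (auto simp: N_def)
  have vT: "T \<le> v n" if "N \<le> n" for n
    using v_ge_midpoint[of n] n1[of n] n1[of "Suc n"] N \<tau> that by simp
  have dec: "\<nu> (Suc (Suc n)) \<le> \<nu> (Suc n)" if "N \<le> n" for n
    using n0[of "Suc n"] N that by simp
  define I where "I = integral {\<tau>..T} g"
  define R where "R = P (Suc N)"
  have R: "0 < R" by (simp add: R_def P_pos)
  have main: "I * (\<tau> powr (\<epsilon> / p) * R powr (- \<epsilon> / p)) \<le> c" if \<epsilon>: "0 < \<epsilon>" for \<epsilon>
  proof (cases "0 \<le> I")
    case I: True
    define S where "S = suminf (tail N \<epsilon>)"
    have S_ge: "R powr (- \<epsilon>) \<le> \<epsilon> * S"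
      unfolding S_def R_def using tail_sum_ge[OF \<epsilon> N(1)] dec by blast
    then have S: "0 < S"
      using R \<epsilon> by (metis less_le_trans powr_gt_zero zero_less_mult_pos less_irrefl)
    have scaled_fun: "normf (test_f \<epsilon>) = ennreal ((1 / \<epsilon>) powr (1 / p))"
      and scaled_seq: "norma (test_a N \<epsilon>) = ennreal (S powr (1 / q))"
      using \<epsilon> S N by (simp_all add: normf_test_f norma_test_a S_def[symmetric] epowr_ennreal)
    have "admf (test_f \<epsilon>)" "adma (test_a N \<epsilon>)"
      using scaled_fun scaled_seq \<epsilon> S test_f_measurable test_f_nonneg test_a_nonneg by (simp_all add: adm_fun_def adm_seq_def)
    then have "bilinear_form (test_f \<epsilon>) (test_a N \<epsilon>)
        < ennreal c * ennreal ((1 / \<epsilon>) powr (1 / p)) * ennreal (S powr (1 / q))"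
      using bound[of "test_f \<epsilon>" "test_a N \<epsilon>"] by (simp only: scaled_fun scaled_seq)
    with bilinear_form_test_ge[OF \<epsilon> N(1) \<tau> vT]
    have "ennreal (\<tau> powr (\<epsilon> / p) * I * S) < ennreal (c * (1 / \<epsilon>) powr (1 / p) * S powr (1 / q))"
      unfolding I_def S_def using c by (simp add: ennreal_mult le_less_trans)
    then have "\<tau> powr (\<epsilon> / p) * I * S < c * (1 / \<epsilon>) powr (1 / p) * S powr (1 / q)"
      using I S by (subst (asm) ennreal_less_iff) auto
    moreover have "S = S powr (1 / p) * S powr (1 / q)"
      using S pq by (simp flip: powr_add)
    then have "\<tau> powr (\<epsilon> / p) * I * S = (\<tau> powr (\<epsilon> / p) * I * S powr (1 / p)) * S powr (1 / q)"
      by (simp only: mult.assoc)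
    ultimately have "(\<tau> powr (\<epsilon> / p) * I * S powr (1 / p)) * S powr (1 / q) < (c * (1 / \<epsilon>) powr (1 / p)) * S powr (1 / q)"
      by simp
    then have "\<tau> powr (\<epsilon> / p) * I * S powr (1 / p) \<le> c * (1 / \<epsilon>) powr (1 / p)"
      using S by simp
    then have "\<tau> powr (\<epsilon> / p) * I * S powr (1 / p) * \<epsilon> powr (1 / p) \<le> c * (1 / \<epsilon>) powr (1 / p) * \<epsilon> powr (1 / p)"
      by (rule mult_right_mono) simp
    then have *: "\<tau> powr (\<epsilon> / p) * I * (\<epsilon> * S) powr (1 / p) \<le> c"
      using \<epsilon> S by (simp add: powr_mult powr_divide mult_ac)
    have "R powr (- \<epsilon> / p) = (R powr (- \<epsilon>)) powr (1 / p)"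
      by (simp add: powr_powr)
    also have "\<dots> \<le> (\<epsilon> * S) powr (1 / p)"
      using S_ge p by (intro powr_mono2) auto
    finally have "\<tau> powr (\<epsilon> / p) * I * R powr (- \<epsilon> / p) \<le> \<tau> powr (\<epsilon> / p) * I * (\<epsilon> * S) powr (1 / p)"
      using I by (intro mult_left_mono) auto
    with * show ?thesis
      by (simp add: mult_ac)
  next
    case False
    then have "I * (\<tau> powr (\<epsilon> / p) * R powr (- \<epsilon> / p)) \<le> 0"
      by (intro mult_nonpos_nonneg) auto
    with c show ?thesis by linarith
  qed
  have "((\<lambda>\<epsilon>. I * (\<tau> powr (\<epsilon> / p) * R powr (- \<epsilon> / p))) \<longlongrightarrow> I * (\<tau> powr (0 / p) * R powr (- 0 / p))) (at_right 0)"
    using \<tau> R p by (intro tendsto_intros) auto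
  moreover have "eventually (\<lambda>\<epsilon>. I * (\<tau> powr (\<epsilon> / p) * R powr (- \<epsilon> / p)) \<le> c) (at_right 0)"
    using main by (auto simp: eventually_at_filter)
  ultimately have "I * (\<tau> powr (0 / p) * R powr (- 0 / p)) \<le> c"
    by (rule tendsto_upperbound) simp
  then show ?thesis
    using \<tau> R by (simp add: I_def)
qed

lemma k_le_if_bound:
  assumes bound: "\<And>f a. admf f \<Longrightarrow> adma a \<Longrightarrow> bilinear_form f a < ennreal c * normf f * norma a"
    and c: "0 \<le> c"
  shows "k \<le> c"
proof -
  define J where "J j = {1 / real (Suc j)..real (Suc j)}" for j
  have incr: "J j \<subseteq> J (Suc j)" for j
    by (auto simp: J_def field_simps)
  have pos: "t \<in> J j \<Longrightarrow> 0 < t" for t j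
    by (auto simp: J_def intro: less_le_trans[of 0 "1 / real (Suc j)"])
  have "ennreal k = (\<integral>\<^sup>+t. (SUP j. ennreal (g t) * indicator (J j) t) \<partial>lborel)"
    unfolding nn_integral_g_lborel[symmetric]
  proof (intro nn_integral_cong)
    fix t :: real
    show "ennreal (g t) * indicator {0<..} t = (SUP j. ennreal (g t) * indicator (J j) t)"
    proof (cases "0 < t")
      case True
      obtain j where j: "max t (1 / t) \<le> real j"
        using real_arch_simple by blast
      then have "t \<in> J j"
        using True by (auto simp: J_def field_simps)
      then show ?thesis
        using True by (intro antisym SUP_upper2[of j] SUP_least) (auto split: split_indicator)
    next
      case False
      then have "t \<notin> J j" for j
        using pos by blast
      with False show ?thesis by simp
    qed
  qed
  also have "\<dots> = (SUP j. \<integral>\<^sup>+t\<in>J j. ennreal (g t) \<partial>lborel)"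
  proof (rule nn_integral_monotone_convergence_SUP)
    show "incseq (\<lambda>j t. ennreal (g t) * indicator (J j) t)"
      using incr by (intro incseq_SucI le_funI) (auto split: split_indicator)
  qed (auto simp: J_def)
  also have "\<dots> \<le> ennreal c"
  proof (intro SUP_least)
    fix j
    have "set_integrable lebesgue (J j) g"
      by (rule set_integrable_subset[OF set_integrable_g]) (use pos in \<open>auto simp: J_def\<close>)
    then have "g integrable_on J j"
      by (rule set_lebesgue_integral_eq_integral(1))
    then have "(\<integral>\<^sup>+t\<in>J j. ennreal (g t) \<partial>lborel) = ennreal (integral (J j) g)"
      using g_nonneg by (intro nn_integral_has_integral_lebesgue' integrable_integral)
    also have "\<dots> \<le> ennreal c"
      unfolding J_def by (intro ennreal_leI truncated_integral_le[OF bound c]) (auto simp: field_simps)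
    finally show "(\<integral>\<^sup>+t\<in>J j. ennreal (g t) \<partial>lborel) \<le> ennreal c" .
  qed
  finally show ?thesis
    using c by simp
qed

text \<open>A negative constant is read as \<open>0\<close> in the extended nonnegative reals, so
it is covered by the constant \<open>0\<close>, which is still below \<open>k(\<sigma>)\<close>.\<close>

lemma no_bound_below_k:
  assumes "c < k"
  shows "\<exists>f a. admf f \<and> adma a \<and> \<not> bilinear_form f a < ennreal c * normf f * norma a"
proof (rule ccontr)
  assume not: "\<not> ?thesis"
  have "bilinear_form f a < ennreal (max 0 c) * normf f * norma a" if "admf f" "adma a" for f a
  proof -
    have "ennreal (max 0 c) = ennreal c"
      by (auto simp: max_def ennreal_neg)
    with not that show ?thesis
      by auto
  qed
  then have "k \<le> max 0 c"
    by (rule k_le_if_bound) auto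
  with assms k_pos show False by simp
qed

theorem best_constants:
  shows "best_possible (\<lambda>C. \<forall>f a. admf f \<longrightarrow> adma a \<longrightarrow> bilinear_form f a < ennreal C * normf f * norma a) k"
    and "best_possible (\<lambda>C. \<forall>f. admf f \<longrightarrow> norm_of_transform f < ennreal C * normf f) k"
    and "best_possible (\<lambda>C. \<forall>a. adma a \<longrightarrow> norm_of_cotransform a < ennreal C * norma a) k"
proof -
  show "best_possible (\<lambda>C. \<forall>f a. admf f \<longrightarrow> adma a \<longrightarrow> bilinear_form f a < ennreal C * normf f * norma a) k"
    unfolding best_possible_def
    using transform_bound bilinear_form_less_if_transform_less no_bound_below_k by blast
  show "best_possible (\<lambda>C. \<forall>f. admf f \<longrightarrow> norm_of_transform f < ennreal C * normf f) k"
    unfolding best_possible_def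
    using transform_bound bilinear_form_less_if_transform_less no_bound_below_k by blast
  show "best_possible (\<lambda>C. \<forall>a. adma a \<longrightarrow> norm_of_cotransform a < ennreal C * norma a) k"
    unfolding best_possible_def
    using cotransform_bound bilinear_form_less_if_cotransform_less no_bound_below_k by blast
qed

end

theorem theorem2:
  fixes \<alpha> \<rho> \<gamma> \<sigma> \<delta> p q :: real
    and \<nu> \<nu>t :: "nat \<Rightarrow> real"
    and \<mu> :: "real \<Rightarrow> real"
  assumes "\<And>n. n \<ge> 1 \<Longrightarrow> \<nu> n > 0"
    and "\<And>n. n \<ge> 1 \<Longrightarrow> \<nu>t n \<in> {0..\<nu> n / 2}"
    and "continuous_on {0<..} \<mu>"
    and "\<And>t. t > 0 \<Longrightarrow> \<mu> t > 0"
    and "\<And>x. x > 0 \<Longrightarrow> set_integrable lebesgue {0<..<x} \<mu>"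
    and "0 \<le> \<alpha>" and "\<alpha> \<le> \<rho>" and "\<rho> > 0"
    and "0 < \<gamma>" and "\<gamma> < \<sigma>" and "\<sigma> \<le> 1"
    and "\<delta> \<in> {-1, 1}"
    and "p > 1" and "1 / p + 1 / q = 1"
    and "\<exists>n0\<ge>1. \<forall>n\<ge>n0. \<nu> n \<ge> \<nu> (Suc n)"
    and "U_inf \<mu> = \<infinity>" and "V_inf \<nu> = \<infinity>"
  shows "best_possible (\<lambda>C. \<forall>f a.
            adm_fun p (\<Phi> p \<delta> \<sigma> \<mu>) f \<longrightarrow> adm_seq q (\<Psi>t q \<sigma> \<nu> \<nu>t) a \<longrightarrow>
            (\<Sum>n. \<integral>\<^sup>+x\<in>{0<..}. ennreal (H \<alpha> \<rho> \<gamma> \<delta> \<mu> \<nu> \<nu>t x (Suc n) * a (Suc n) * f x) \<partial>lebesgue)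
            < ennreal C * fun_norm p (\<Phi> p \<delta> \<sigma> \<mu>) f * seq_norm q (\<Psi>t q \<sigma> \<nu> \<nu>t) a)
          (k_const \<alpha> \<rho> \<gamma> \<sigma>)
       \<and> best_possible (\<lambda>C. \<forall>f.
            adm_fun p (\<Phi> p \<delta> \<sigma> \<mu>) f \<longrightarrow>
            (\<Sum>n. ennreal (\<nu> (Suc n) / Vt \<nu> \<nu>t (Suc n) powr (1 - p * \<sigma>)) *
               (\<integral>\<^sup>+x\<in>{0<..}. ennreal (H \<alpha> \<rho> \<gamma> \<delta> \<mu> \<nu> \<nu>t x (Suc n) * f x) \<partial>lebesgue) epowr p)
              epowr (1 / p)
            < ennreal C * fun_norm p (\<Phi> p \<delta> \<sigma> \<mu>) f)
          (k_const \<alpha> \<rho> \<gamma> \<sigma>)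
       \<and> best_possible (\<lambda>C. \<forall>a.
            adm_seq q (\<Psi>t q \<sigma> \<nu> \<nu>t) a \<longrightarrow>
            (\<integral>\<^sup>+x\<in>{0<..}. ennreal (\<mu> x / U \<mu> x powr (1 - q * \<delta> * \<sigma>)) *
               (\<Sum>n. ennreal (H \<alpha> \<rho> \<gamma> \<delta> \<mu> \<nu> \<nu>t x (Suc n) * a (Suc n))) epowr q \<partial>lebesgue)
              epowr (1 / q)
            < ennreal C * seq_norm q (\<Psi>t q \<sigma> \<nu> \<nu>t) a)
          (k_const \<alpha> \<rho> \<gamma> \<sigma>)"
proof -
  have "\<bar>\<delta>\<bar> = 1"
    using assms(12) by auto
  then interpret half_discrete_divergent \<mu> \<alpha> \<rho> \<gamma> \<sigma> \<delta> p q \<nu> \<nu>t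
    using assms by unfold_locales auto
  show ?thesis
    by (intro conjI best_constants)
qed

end
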